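(* Let $\Omega\subset\mathbb{R}^d$ be any open set. Assume that there are $x_0\in B_{1/2}$ and $\varrho>0$ such that $B_{2\varrho}(x_0)\subset\Omega\cap B_{1/2}$. Then there exist $\delta>0$ and $C>0$, depending only on $d,\alpha,\varrho,\varphi,\lambda,\Lambda$, such that the following holds. Let $u_1,u_2:\mathbb{R}^d\to\mathbb{R}$, with $u_1,u_2\in C(B_1)$, be such that for all $a,b\in\mathbb{R}$ $$\widetilde{\mathcal{M}}^+(au_1+bu_2)\ge-\delta(|a|+|b|)\quad\text{in }B_1\cap\Omega$$ in the viscosity sense, $u_1=u_2=0$ in $B_1\setminus\Omega$, and for $i=1,2$ $$u_i\ge0\ \text{ in }\mathbb{R}^d,\qquad \int_{\mathbb{R}^d}\frac{u_i(y)}{1+|y|^{d+\alpha}}\,dy+\int_{\mathbb{R}^d}\frac{u_i(y)}{1+|y|^d(\varphi(1/|y|))^{-1}}\,dy=1 .$$ Then $$C^{-1}u_2\le u_1\le C\,u_2\qquad\text{in }B_{1/2}.$$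
   Context: Setting. $d\ge1$ is the dimension, $0<\lambda\le\Lambda$ are constants, $\beta\in(0,2)$, $\alpha\in(\beta,2)$. The function $\varphi:(0,\infty)\to(0,\infty)$ is locally bounded, non-decreasing, and satisfies, for some constant $\kappa_\circ>0$, $\varphi(st)\le\kappa_\circ s^\beta\varphi(t)$ for all $s\ge1$, $t>0$, and $\int_0^1\frac{\varphi(y)}{y}\,dy<\infty$. Dependence of constants on $\varphi$ includes dependence on $\beta,\kappa_\circ$. Operator. With $\delta(u,x,y)=u(x+y)+u(x-y)-2u(x)$ and its positive and negative parts $\delta^\pm(u,x,y)$ (not to be confused with the constant $\delta$ in the claim), $$\widetilde{\mathcal{M}}^+u(x)=\int_{\mathbb{R}^d}\frac{\Lambda\,\delta^+(u,x,y)-\lambda\,\delta^-(u,x,y)}{|y|^d}\Bigl(\frac{2-\alpha}{|y|^\alpha}+\varphi(1/|y|)\Bigr)dy .$$ Viscosity sense. A function $u$ satisfies $Iu\ge g$ in an open set $U$ in the viscosity sense (viscosity subsolution) if, whenever a $C^2$ function $\psi$ touches $u$ from above at $x\in U$ in a small neighbourhood $N_x\Subset U$ (i.e. $\psi\ge u$ in $N_x$ and $\psi(x)=u(x)$), the function $v$ equal to $\psi$ in $N_x$ and to $u$ elsewhere satisfies $Iv(x)\ge g(x)$. (The paper's general definition asks $u$ to be bounded on $\mathbb{R}^d$ to guarantee integrability at infinity against the kernel; it remarks that suitable integrability suffices instead, and here the integral condition plays that role.) $B_r$, $B_r(x)$ are the balls of radius $r$ centred at $0$ and at $x$. *)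

theory Defs
  imports "HOL-Analysis.Analysis"
begin

text \<open>The dimension is \<open>DIM('a)\<close>, for an arbitrary Euclidean space \<open>'a\<close>.\<close>

definition second_diff :: "('a::euclidean_space \<Rightarrow> real) \<Rightarrow> 'a \<Rightarrow> 'a \<Rightarrow> real" where
  "second_diff u x y = u (x + y) + u (x - y) - 2 * u x"

text \<open>
  An integral with values in the extended reals, so that divergence to \<open>\<infinity>\<close> or \<open>-\<infinity>\<close>
  is recorded (the Bochner integral of a non-integrable function is \<open>0\<close>).
  It is meant for measurable functions whose positive or negative part has a finite integral;
  note that \<^term>\<open>ennreal\<close> sends negative reals to \<open>0\<close>.
\<close>

definition ext_integral :: "('a::euclidean_space \<Rightarrow> real) \<Rightarrow> ereal" where
  "ext_integral f =
     enn2ereal (\<integral>\<^sup>+ y. ennreal (f y) \<partial>lebesgue) - enn2ereal (\<integral>\<^sup>+ y. ennreal (- f y) \<partial>lebesgue)"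

lemma ext_integral_eq:
  assumes "integrable lebesgue f"
  shows "ext_integral f = ereal (integral\<^sup>L lebesgue f)"
proof -
  from assms obtain r q where r: "0 \<le> r" "(\<integral>\<^sup>+ y. ennreal (f y) \<partial>lebesgue) = ennreal r"
    and q: "0 \<le> q" "(\<integral>\<^sup>+ y. ennreal (- f y) \<partial>lebesgue) = ennreal q"
    and rq: "integral\<^sup>L lebesgue f = r - q"
    by (rule integrableE)
  then show ?thesis
    by (simp add: ext_integral_def)
qed

text \<open>The value of the integrand at \<open>y = 0\<close>, where \<open>\<phi> (1 / 0) = \<phi> 0\<close> is arbitrary, is immaterial.\<close>

definition Mplus ::
  "real \<Rightarrow> real \<Rightarrow> real \<Rightarrow> (real \<Rightarrow> real) \<Rightarrow> ('a::euclidean_space \<Rightarrow> real) \<Rightarrow> 'a \<Rightarrow> ereal" where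
  "Mplus lam Lam \<alpha> \<phi> u x =
     ext_integral (\<lambda>y.
       (Lam * max (second_diff u x y) 0 - lam * max (- second_diff u x y) 0) / norm y ^ DIM('a)
       * ((2 - \<alpha>) / norm y powr \<alpha> + \<phi> (1 / norm y)))"

text \<open>\<open>C\<^sup>2\<close> on an open set, with Frechet derivatives.\<close>

definition C2_on :: "('a::euclidean_space \<Rightarrow> real) \<Rightarrow> 'a set \<Rightarrow> bool" where
  "C2_on \<psi> S \<longleftrightarrow>
     (\<exists>(D :: 'a \<Rightarrow> 'a \<Rightarrow>\<^sub>L real) (D2 :: 'a \<Rightarrow> 'a \<Rightarrow>\<^sub>L 'a \<Rightarrow>\<^sub>L real).
        (\<forall>x\<in>S. (\<psi> has_derivative blinfun_apply (D x)) (at x)) \<and>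
        (\<forall>x\<in>S. (D has_derivative blinfun_apply (D2 x)) (at x)) \<and>
        continuous_on S D2)"

definition viscosity_subsolution ::
  "(('a::euclidean_space \<Rightarrow> real) \<Rightarrow> 'a \<Rightarrow> ereal) \<Rightarrow> ('a \<Rightarrow> real) \<Rightarrow> ('a \<Rightarrow> real) \<Rightarrow> 'a set \<Rightarrow> bool" where
  "viscosity_subsolution I u g U \<longleftrightarrow>
     (\<forall>x\<in>U. \<forall>N \<psi>.
        open N \<and> x \<in> N \<and> compact (closure N) \<and> closure N \<subseteq> U \<and>
        C2_on \<psi> N \<and> (\<forall>z\<in>N. u z \<le> \<psi> z) \<and> \<psi> x = u x
        \<longrightarrow> ereal (g x) \<le> I (\<lambda>z. if z \<in> N then \<psi> z else u z) x)"

text \<open>Integrability is part of the condition; as the weights are positive and measurable, it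
  also makes \<open>u\<close> Lebesgue measurable.\<close>

definition normalised :: "real \<Rightarrow> (real \<Rightarrow> real) \<Rightarrow> ('a::euclidean_space \<Rightarrow> real) \<Rightarrow> bool" where
  "normalised \<alpha> \<phi> u \<longleftrightarrow>
     integrable lebesgue (\<lambda>y. u y / (1 + norm y powr (real DIM('a) + \<alpha>))) \<and>
     integrable lebesgue (\<lambda>y. u y / (1 + norm y ^ DIM('a) * inverse (\<phi> (1 / norm y)))) \<and>
     (LINT y|lebesgue. u y / (1 + norm y powr (real DIM('a) + \<alpha>))) +
     (LINT y|lebesgue. u y / (1 + norm y ^ DIM('a) * inverse (\<phi> (1 / norm y)))) = 1"

end

(*
  Every step tests the viscosity inequality with a paraboloid at an extremal point x, dominates the
  integrand pointwise by an integrable function H, and contradicts g(x) <= integral of H.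

  Interior upper bound: at a maximum point of u(x) (15/16 - |x|)^d with value L, slide a flat
  paraboloid over the ball of radius 2s proportional to 15/16 - |x|.  The integral of u being at
  most 1, u is below L/2 on most of that ball, so the negative part contributes about
  -L s^(-alpha).  The positive part contributes a small multiple of L s^(-alpha) and the tail
  s^(-d-alpha), which is of lower order when L (15/16 - |x|)^d is large.

  Interior lower bound: if u is less than c at some point of B_rho(x0), a paraboloid of height
  about c touches u from below; the mass of u makes the operator at the contact point exceed a
  fixed positive number, the paraboloid costs only a multiple of c.

  Comparison: if u1 - C u2 > 0 at z, touch it from above by m + 16 M |x - z|^2.  This paraboloid
  exceeds u1 for 3/4 <= |x| <= 7/8, so the contact point stays inside; u1 - C u2 is very negative
  on B_rho(x0) when C is large, and this dominates all other contributions.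
*)

theory Submission
  imports Defs
begin

section \<open>Integrals and paraboloids\<close>

text \<open>Beyond the unit ball, \<open>u\<close> is controlled only by its unit integral against
  \<open>weight\<close>. Hence two comparisons of the kernel with the weight shifted to the contact
  point: \<open>kern_le_weight\<close> turns far contributions of \<open>u\<close> into multiples of
  that integral, and \<open>kern_ge_weight\<close> makes the same integral felt at the contact point
  wherever the mass sits. The growth condition with \<open>\<beta> < \<alpha>\<close> subordinates
  the \<open>\<phi>\<close>-part of the kernel to its fractional part near 0; the Dini condition
  makes the kernel integrable at infinity, so that a constant has finite cost there. The boundary of
  \<open>\<Omega>\<close> is arbitrary, so no barriers exist near it. In the upper bound and in the
  comparison the tested function is positive at the contact point, while it is at most 0 on the rest
  of the unit ball outside \<open>\<Omega>\<close>; this places the contact point in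
  \<open>\<Omega>\<close>. The sign is of no help for \<open>-u\<close>, so the lower bound is
  confined to a ball inside \<open>\<Omega>\<close>. Constants are fixed in the order
  \<open>M\<close> and \<open>c\<close>, then \<open>C\<close>, then \<open>\<delta>\<close>: the
  inequality for \<open>u1 - C * u2\<close> has right-hand side
  \<open>-\<delta> * (1 + C)\<close>.\<close>

lemma ext_integral_upper_bound:
  fixes F H :: "'a::euclidean_space \<Rightarrow> real"
  assumes H: "integrable lebesgue H" and le: "AE y in lebesgue. F y \<le> H y"
  shows "ext_integral F \<le> ereal (integral\<^sup>L lebesgue H)"
proof -
  \<comment> \<open>Both halves are monotone for arbitrary functions, so \<open>F\<close> need not
    be measurable; only the majorant has to be integrable.\<close>
  have "(\<integral>\<^sup>+ y. ennreal (F y) \<partial>lebesgue) \<le> (\<integral>\<^sup>+ y. ennreal (H y) \<partial>lebesgue)"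
    using le by (intro nn_integral_mono_AE) (auto elim!: eventually_mono intro: ennreal_leI)
  moreover have "(\<integral>\<^sup>+ y. ennreal (- H y) \<partial>lebesgue) \<le> (\<integral>\<^sup>+ y. ennreal (- F y) \<partial>lebesgue)"
    using le by (intro nn_integral_mono_AE) (auto elim!: eventually_mono intro: ennreal_leI)
  ultimately have "ext_integral F \<le> ext_integral H"
    unfolding ext_integral_def by (intro ereal_minus_mono) (auto simp: less_eq_ennreal.rep_eq)
  then show ?thesis
    using ext_integral_eq[OF H] by simp
qed

lemma C2_on_paraboloid:
  fixes c P :: real and z0 :: "'a::euclidean_space"
  shows "C2_on (\<lambda>z. c + P * (norm (z - z0))\<^sup>2) S"
proof -
  define B :: "'a \<Rightarrow> 'a \<Rightarrow>\<^sub>L real" where "B v = blinfun_inner_left v" for v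
  have B: "bounded_linear B"
    unfolding B_def by (rule bounded_linear_blinfun_inner_left)
  define E :: "'a \<Rightarrow>\<^sub>L 'a \<Rightarrow>\<^sub>L real" where "E = (2 * P) *\<^sub>R Blinfun B"
  show ?thesis
    unfolding C2_on_def
  proof (intro exI conjI ballI)
    fix x :: 'a
    show "((\<lambda>z. c + P * (norm (z - z0))\<^sup>2) has_derivative
        blinfun_apply ((2 * P) *\<^sub>R B (x - z0))) (at x)"
      unfolding power2_norm_eq_inner B_def
      by (auto intro!: derivative_eq_intros simp: inner_commute scaleR_blinfun.rep_eq algebra_simps)
    have *: "((\<lambda>x. (2 * P) *\<^sub>R B (x - z0)) has_derivative (\<lambda>h. (2 * P) *\<^sub>R B h)) (at x)"
      by (auto intro!: derivative_eq_intros bounded_linear.has_derivative[OF B])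
    \<comment> \<open>The redex \<open>(\<lambda>_. E) x\<close> makes unification choose a constant
      second derivative, whose continuity is then trivial.\<close>
    then show "((\<lambda>x. (2 * P) *\<^sub>R B (x - z0)) has_derivative blinfun_apply ((\<lambda>_. E) x)) (at x)"
      unfolding E_def by (simp add: scaleR_blinfun.rep_eq bounded_linear_Blinfun_apply[OF B])
  qed simp
qed

text \<open>Serves the two arguments \<open>x + y\<close> and \<open>x - y\<close> of a second
  difference, that is \<open>c = 1\<close> and \<open>c = -1\<close>. The map is written
  coordinatewise to fit the affine change of variables, whose Jacobian is then a product of
  ones.\<close>

lemma lebesgue_integral_affine_unit:
  fixes f :: "'a::euclidean_space \<Rightarrow> real" and c :: real
  assumes c: "\<bar>c\<bar> = 1" and f: "integrable lebesgue f"
  shows "integrable lebesgue (\<lambda>y. f (a + c *\<^sub>R y))"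
    and "(LINT y|lebesgue. f (a + c *\<^sub>R y)) = integral\<^sup>L lebesgue f"
proof -
  define T where "T = (\<lambda>y::'a. a + (\<Sum>j\<in>Basis. (c * (y \<bullet> j)) *\<^sub>R j))"
  have T: "T y = a + c *\<^sub>R y" for y
  proof -
    have "(\<Sum>j\<in>Basis. (c * (y \<bullet> j)) *\<^sub>R j) = c *\<^sub>R (\<Sum>j\<in>Basis. (y \<bullet> j) *\<^sub>R j)"
      by (simp add: scaleR_sum_right)
    then show ?thesis
      by (simp add: T_def euclidean_representation)
  qed
  have nz: "c \<noteq> 0" using c by auto
  have m: "T \<in> lebesgue \<rightarrow>\<^sub>M lebesgue"
    unfolding T_def by (rule lebesgue_affine_measurable) (use nz in auto)
  have "lebesgue = density (distr lebesgue lebesgue T) (\<lambda>_. \<Prod>j\<in>(Basis::'a set). \<bar>c\<bar>)"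
    unfolding T_def by (rule lebesgue_affine_euclidean) (use nz in auto)
  then have eq: "distr lebesgue lebesgue T = lebesgue"
    by (simp add: c density_1)
  have "integrable (distr lebesgue lebesgue T) f" using f eq by simp
  then show "integrable lebesgue (\<lambda>y. f (a + c *\<^sub>R y))"
    using integrable_distr[OF m] by (simp add: T)
  have fm: "f \<in> borel_measurable lebesgue" using f by auto
  show "(LINT y|lebesgue. f (a + c *\<^sub>R y)) = integral\<^sup>L lebesgue f"
    using integral_distr[OF m fm] unfolding eq by (simp add: T)
qed

definition pucci :: "real \<Rightarrow> real \<Rightarrow> real \<Rightarrow> real" where
  "pucci lam Lam t = Lam * max t 0 - lam * max (- t) 0"

text \<open>\<open>pucci lam Lam t\<close> is the supremum of \<open>a * t\<close> over
  \<open>lam \<le> a \<le> Lam\<close>, and each such \<open>a\<close> satisfies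
  \<open>a * (P - Q) \<le> Lam * P - lam * Q\<close>. \<open>P\<close> and \<open>Q\<close> need not
  be the positive and negative parts of \<open>t\<close>, so costs and gains can be estimated
  separately.\<close>

lemma pucci_le:
  assumes "0 \<le> lam" "lam \<le> Lam" "0 \<le> P" "0 \<le> Q" "t \<le> P - Q"
  shows "pucci lam Lam t \<le> Lam * P - lam * Q"
proof (cases "0 \<le> t")
  case True
  then have "pucci lam Lam t = Lam * t" by (simp add: pucci_def)
  also have "\<dots> \<le> Lam * (P - Q)" using assms by (intro mult_left_mono) auto
  also have "\<dots> \<le> Lam * P - lam * Q"
    using mult_right_mono[of lam Lam Q] assms by (simp add: algebra_simps)
  finally show ?thesis .
next
  case False
  then have "pucci lam Lam t = lam * t" by (simp add: pucci_def)
  also have "\<dots> \<le> lam * (P - Q)" using assms by (intro mult_left_mono) auto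
  also have "\<dots> \<le> Lam * P - lam * Q"
    using mult_right_mono[of lam Lam P] assms by (simp add: algebra_simps)
  finally show ?thesis .
qed

text \<open>At each point a single term of the sum already dominates \<open>F\<close>, so the sets
  may overlap. Dyadic shells can thus be enlarged to full balls, whose volumes are explicit, at the
  price of a constant factor.\<close>

lemma nn_integral_le_suminf_cover:
  fixes F :: "'a::euclidean_space \<Rightarrow> ennreal"
  assumes cover: "\<And>y. F y \<noteq> 0 \<Longrightarrow> \<exists>k::nat. y \<in> S k \<and> F y \<le> b k"
    and meas: "\<And>k. S k \<in> sets lebesgue"
  shows "(\<integral>\<^sup>+ y. F y \<partial>lebesgue) \<le> (\<Sum>k. b k * emeasure lebesgue (S k))"
proof -
  have "(\<integral>\<^sup>+ y. F y \<partial>lebesgue) \<le> (\<integral>\<^sup>+ y. (\<Sum>k. b k * indicator (S k) y) \<partial>lebesgue)"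
  proof (rule nn_integral_mono)
    fix y :: 'a
    show "F y \<le> (\<Sum>k. b k * indicator (S k) y)"
    proof (cases "F y = 0")
      case False
      then obtain k where k: "y \<in> S k" "F y \<le> b k" using cover by blast
      define g where "g = (\<lambda>j. b j * indicator (S j) y)"
      have "F y \<le> g k" using k by (simp add: g_def)
      also have "g k = sum g {k}" by simp
      also have "\<dots> \<le> suminf g" by (rule sum_le_suminf) auto
      also have "\<dots> = (\<Sum>k. b k * indicator (S k) y)" by (simp add: g_def)
      finally show ?thesis .
    qed simp
  qed
  also have "\<dots> = (\<Sum>k. \<integral>\<^sup>+ y. b k * indicator (S k) y \<partial>lebesgue)"
    using meas by (intro nn_integral_suminf) auto
  also have "\<dots> = (\<Sum>k. b k * emeasure lebesgue (S k))"
    using meas by (simp add: nn_integral_cmult_indicator)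
  finally show ?thesis .
qed

lemma ball_lebesgue_measure:
  fixes a :: "'a::euclidean_space"
  assumes "0 \<le> r"
  shows "emeasure lebesgue (ball a r) = ennreal (unit_ball_vol DIM('a) * r ^ DIM('a))"
    and "measure lebesgue (ball a r) = unit_ball_vol DIM('a) * r ^ DIM('a)"
proof -
  show "emeasure lebesgue (ball a r) = ennreal (unit_ball_vol DIM('a) * r ^ DIM('a))"
    using emeasure_ball[OF assms, of a] by simp
  then show "measure lebesgue (ball a r) = unit_ball_vol DIM('a) * r ^ DIM('a)"
    using assms by (simp add: measure_def)
qed

lemma dyadic_scale:
  fixes x :: real
  assumes "1 \<le> x"
  shows "\<exists>k::nat. 2 ^ k \<le> x \<and> x < 2 ^ Suc k"
proof -
  define k where "k = nat \<lfloor>log 2 x\<rfloor>"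
  have l: "0 \<le> log 2 x" using assms by simp
  have "real k \<le> log 2 x" "log 2 x < real k + 1" using l unfolding k_def by linarith+
  then have "2 powr k \<le> x" "x < 2 powr (real k + 1)"
    using assms by (simp_all add: le_log_iff log_less_iff)
  then show ?thesis
    by (intro exI[of _ k]) (simp add: powr_realpow powr_add mult.commute)
qed

text \<open>The dyadic shells around 0 contribute a geometric series of ratio
  \<open>2 powr - e\<close> with \<open>e = DIM('a) + 2 - p > 0\<close>. With
  \<open>p = DIM('a) + \<alpha>\<close> this is the cost of a paraboloid near the origin, and
  \<open>e > 0\<close> is the condition \<open>\<alpha> < 2\<close>.\<close>

lemma integrable_radial_power:
  fixes p :: real
  assumes p: "0 \<le> p" "p < real DIM('a) + 2"
  obtains C where "0 < C"
    "\<And>r. 0 < r \<Longrightarrow> integrable lebesgue (\<lambda>y::'a::euclidean_space. indicator (ball 0 r) y * ((norm y)\<^sup>2 * norm y powr - p))"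
    "\<And>r. 0 < r \<Longrightarrow> (LINT y|lebesgue. indicator (ball (0::'a) r) y * ((norm y)\<^sup>2 * norm y powr - p)) \<le> C * r powr (real DIM('a) + 2 - p)"
proof -
  define e where "e = real DIM('a) + 2 - p"
  define V where "V = unit_ball_vol DIM('a)"
  define q where "q = (1/2::real) powr e"
  define C where "C = V * 2 ^ DIM('a) * 2 powr p * (1 / (1 - q))"
  have V: "V > 0" unfolding V_def by simp
  have e: "e > 0" using p e_def by simp
  have "q = 2 powr - e" unfolding q_def by (simp add: powr_minus_divide powr_divide)
  also have "\<dots> < 2 powr 0" using e by (intro powr_less_mono) auto
  finally have q: "0 < q" "q < 1" unfolding q_def by auto
  have C: "C > 0" unfolding C_def using V q by simp
  have *: "integrable lebesgue (\<lambda>y::'a. indicator (ball 0 r) y * ((norm y)\<^sup>2 * norm y powr - p)) \<and>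
      (LINT y|lebesgue. indicator (ball (0::'a) r) y * ((norm y)\<^sup>2 * norm y powr - p)) \<le> C * r powr e"
    if r: "r > 0" for r
  proof -
    define F where "F = (\<lambda>y::'a. indicator (ball 0 r) y * ((norm y)\<^sup>2 * norm y powr - p))"
    \<comment> \<open>Bound on the shell between \<open>r / 2 ^ Suc k\<close> and
      \<open>r / 2 ^ k\<close>: the square is taken at the outer radius, the negative power at the
      inner one.\<close>
    define b where "b k = (r / 2^k)\<^sup>2 * (r / 2^(Suc k)) powr - p" for k :: nat
    have b0: "b k \<ge> 0" for k unfolding b_def by simp
    have meas: "F \<in> borel_measurable lebesgue"
      unfolding F_def by (intro borel_measurable_times borel_measurable_indicator) (auto intro!: measurable_completion)
    have cover: "\<exists>k::nat. y \<in> ball 0 (2 * (r / 2 ^ k)) \<and> ennreal (F y) \<le> ennreal (b k)" if "ennreal (F y) \<noteq> 0" for y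
    proof -
      from that have y: "y \<noteq> 0" "norm y < r" by (auto simp: F_def indicator_def split: if_splits)
      then have "1 \<le> r / norm y" by simp
      then obtain k where k: "2 ^ k \<le> r / norm y" "r / norm y < 2 ^ Suc k" using dyadic_scale by blast
      then have k': "norm y \<le> r / 2^k" "r / 2^Suc k < norm y" using y by (simp_all add: field_simps)
      from y have "F y = (norm y)\<^sup>2 * norm y powr - p" by (simp add: F_def)
      also have "\<dots> \<le> b k" unfolding b_def
        using k' y r p by (intro mult_mono power_mono powr_mono2') auto
      finally have "ennreal (F y) \<le> ennreal (b k)" by (rule ennreal_leI)
      \<comment> \<open>The shell includes its outer sphere while \<open>ball\<close> is open, hence
        the doubled radius.\<close>
      moreover have "norm y < 2 * (r / 2 ^ k)"
        using k'(1) divide_pos_pos[OF r, of "2 ^ k"] by simp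
      ultimately show ?thesis by auto
    qed
    have term_eq: "b k * (V * (2 * (r / 2 ^ k)) ^ DIM('a)) = (V * 2 ^ DIM('a) * 2 powr p * r powr e) * q ^ k" for k
    proof -
      define t where "t = r / 2 ^ k"
      have t: "t > 0" using r by (simp add: t_def)
      have tq: "t powr e = r powr e * q ^ k"
      proof -
        have "t = r * (1/2) powr real k" using r by (simp add: t_def powr_realpow power_divide)
        then have "t powr e = r powr e * ((1/2) powr real k) powr e" using r by (simp add: powr_mult)
        also have "((1/2) powr real k) powr e = (q::real) ^ k" 
          unfolding q_def powr_powr by (simp add: powr_powr mult.commute flip: powr_realpow)
        finally show ?thesis .
      qed
      have "b k = t powr 2 * (t powr - p * 2 powr p)"
        using t unfolding b_def t_def[symmetric]
        by (simp add: t_def powr_divide powr_minus_divide powr_mult field_simps flip: powr_numeral)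
      moreover have "(2 * (r / 2 ^ k)) ^ DIM('a) = 2 ^ DIM('a) * t powr DIM('a)"
        unfolding t_def[symmetric] using t by (simp add: powr_realpow power_mult_distrib)
      ultimately have "b k * (V * (2 * (r / 2 ^ k)) ^ DIM('a)) = V * 2 ^ DIM('a) * 2 powr p * (t powr 2 * t powr - p * t powr DIM('a))"
        by simp
      also have "t powr 2 * t powr - p * t powr DIM('a) = t powr e"
        by (simp add: e_def algebra_simps flip: powr_add)
      finally show ?thesis using tq by simp
    qed
    have "(\<integral>\<^sup>+ y. ennreal (F y) \<partial>lebesgue) \<le> (\<Sum>k. ennreal (b k) * emeasure lebesgue (ball (0::'a) (2 * (r / 2 ^ k))))"
      using cover by (rule nn_integral_le_suminf_cover) auto
    also have "\<dots> = (\<Sum>k. ennreal ((V * 2 ^ DIM('a) * 2 powr p * r powr e) * q ^ k))"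
    proof (rule arg_cong[where f=suminf], rule ext)
      fix k
      show "ennreal (b k) * emeasure lebesgue (ball (0::'a) (2 * (r / 2 ^ k))) = ennreal ((V * 2 ^ DIM('a) * 2 powr p * r powr e) * q ^ k)"
        using r b0[of k] unfolding term_eq[symmetric] by (subst ball_lebesgue_measure) (auto simp: ennreal_mult' V_def)
    qed
    also have "\<dots> = ennreal (\<Sum>k. (V * 2 ^ DIM('a) * 2 powr p * r powr e) * q ^ k)"
      using V q by (intro suminf_ennreal2 summable_mult summable_geometric) auto
    also have "(\<Sum>k. (V * 2 ^ DIM('a) * 2 powr p * r powr e) * q ^ k) = C * r powr e"
      using q by (subst suminf_mult) (auto simp: suminf_geometric C_def intro!: summable_geometric)
    finally have le: "(\<integral>\<^sup>+ y. ennreal (F y) \<partial>lebesgue) \<le> ennreal (C * r powr e)" .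
    have F0: "F y \<ge> 0" for y by (simp add: F_def)
    have int: "integrable lebesgue F"
      using le meas F0 by (intro integrableI_nonneg) (auto simp: less_top[symmetric] top_unique)
    moreover have "integral\<^sup>L lebesgue F \<le> C * r powr e"
      using le F0 C r nn_integral_eq_integral[OF int] by (simp add: ennreal_le_iff)
    ultimately show ?thesis unfolding F_def by auto
  qed
  show ?thesis using * C that[of C] unfolding e_def by auto
qed

lemma lebesgue_integral_translate:
  fixes f :: "'a::euclidean_space \<Rightarrow> real"
  assumes "integrable lebesgue f"
  shows "integrable lebesgue (\<lambda>y. f (a + y))" "(LINT y|lebesgue. f (a + y)) = integral\<^sup>L lebesgue f"
    "integrable lebesgue (\<lambda>y. f (a - y))" "(LINT y|lebesgue. f (a - y)) = integral\<^sup>L lebesgue f"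
  using lebesgue_integral_affine_unit[OF _ assms, of 1 a] lebesgue_integral_affine_unit[OF _ assms, of "-1" a]
  by simp_all

lemma integrable_indicator_ball [simp]:
  "integrable lebesgue (indicator (ball (a::'a::euclidean_space) r) :: 'a \<Rightarrow> real)"
  using emeasure_lborel_ball_finite[of a r] by (intro integrable_real_indicator) auto

lemma integral_indicator_ball:
  "0 \<le> r \<Longrightarrow> (LINT y|lebesgue. indicator (ball (a::'a::euclidean_space) r) y) = unit_ball_vol DIM('a) * r ^ DIM('a)"
  using ball_lebesgue_measure(2)[of r a] by simp

lemma second_diff_paraboloid:
  "second_diff (\<lambda>z. c + P * (norm (z - z0))\<^sup>2) x y = 2 * P * (norm y)\<^sup>2"
  unfolding second_diff_def power2_norm_eq_inner
  by (simp add: inner_add_left inner_add_right inner_diff_left inner_diff_right inner_commute algebra_simps)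

section \<open>The kernel and the weights\<close>

locale pucci_kernel =
  fixes lam Lam \<alpha> \<beta> \<kappa> :: real and \<phi> :: "real \<Rightarrow> real"
  assumes lam: "0 < lam" "lam \<le> Lam"
    and exponents: "0 < \<beta>" "\<beta> < \<alpha>" "\<alpha> < 2"
    and \<kappa>_pos: "0 < \<kappa>"
    and \<phi>_pos: "\<And>t. 0 < t \<Longrightarrow> 0 < \<phi> t"
    and \<phi>_mono: "mono_on {0<..} \<phi>"
    and \<phi>_scaling: "\<And>s t. 1 \<le> s \<Longrightarrow> 0 < t \<Longrightarrow> \<phi> (s * t) \<le> \<kappa> * s powr \<beta> * \<phi> t"
    and \<phi>_dini: "set_integrable lebesgue {0<..<1} (\<lambda>y. \<phi> y / y)"
begin

definition kern :: "'a::euclidean_space \<Rightarrow> real" where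
  "kern y = ((2 - \<alpha>) / norm y powr \<alpha> + \<phi> (1 / norm y)) / norm y ^ DIM('a)"

text \<open>The sum of the two weights in \<^const>\<open>normalised\<close>.\<close>

definition weight :: "'a::euclidean_space \<Rightarrow> real" where
  "weight z = 1 / (1 + norm z powr (real DIM('a) + \<alpha>))
     + 1 / (1 + norm z ^ DIM('a) * inverse (\<phi> (1 / norm z)))"

abbreviation "pucci_fun \<equiv> pucci lam Lam"

lemma \<phi>_le: "0 < s \<Longrightarrow> s \<le> t \<Longrightarrow> \<phi> s \<le> \<phi> t"
  using \<phi>_mono by (auto simp: mono_on_def)

lemma Lam_pos: "0 < Lam"
  using lam by auto

lemma \<alpha>_pos: "0 < \<alpha>"
  using exponents by auto

lemma Mplus_eq:
  "Mplus lam Lam \<alpha> \<phi> u x = ext_integral (\<lambda>y. pucci_fun (second_diff u x y) * kern y)"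
  by (simp add: Mplus_def pucci_def kern_def)

lemma kern_eq:
  fixes y :: "'a::euclidean_space"
  assumes "y \<noteq> 0"
  shows "kern y = (2 - \<alpha>) * norm y powr - (real DIM('a) + \<alpha>) + \<phi> (1 / norm y) * norm y powr - real DIM('a)"
proof -
  have "norm y powr - (real DIM('a) + \<alpha>) = 1 / (norm y powr \<alpha> * norm y ^ DIM('a))"
    using assms by (simp only: powr_minus_divide powr_add) (simp add: powr_realpow mult.commute)
  moreover have "norm y powr - real DIM('a) = 1 / norm y ^ DIM('a)"
    using assms by (simp add: powr_minus_divide powr_realpow)
  ultimately show ?thesis by (simp add: kern_def add_divide_distrib)
qed

section \<open>Pointwise bounds for the kernel near the origin\<close>

lemma kern_nonneg: "0 \<le> kern y"
proof (cases "y = 0")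
  case False
  then show ?thesis
    using exponents \<phi>_pos[of "1 / norm y"] by (auto simp: kern_def intro!: divide_nonneg_nonneg add_nonneg_nonneg)
\<comment> \<open>At \<open>y = 0\<close> the denominator \<open>0 ^ DIM('a)\<close> is 0, so
  division makes the kernel 0 whatever \<open>\<phi> 0\<close> is.\<close>
qed (simp add: kern_def power_0_left)

lemma kern_ge:
  fixes y :: "'a::euclidean_space"
  assumes "y \<noteq> 0"
  shows "(2 - \<alpha>) * norm y powr - (real DIM('a) + \<alpha>) \<le> kern y"
  using kern_eq[OF assms] \<phi>_pos[of "1 / norm y"] assms by simp

text \<open>Scaling from the argument 1 bounds \<open>\<phi> (1 / norm y)\<close> by a multiple of
  \<open>(2 / norm y) powr \<beta>\<close>. The factor \<open>2 / norm y\<close> is at least 1 on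
  the whole range, so the exponent \<open>\<beta>\<close> may be raised to
  \<open>\<alpha>\<close>.\<close>

lemma kern_le:
  obtains C where "0 < C" "\<And>y::'a::euclidean_space. y \<noteq> 0 \<Longrightarrow> norm y \<le> 2 \<Longrightarrow>
    kern y \<le> C * norm y powr - (real DIM('a) + \<alpha>)"
proof
  define C where "C = (2 - \<alpha>) + \<kappa> * 2 powr \<alpha> * \<phi> 1"
  show "0 < C" using exponents \<kappa>_pos \<phi>_pos[of 1] by (auto simp: C_def intro!: add_pos_pos)
  fix y :: 'a
  assume y: "y \<noteq> 0" "norm y \<le> 2"
  have "\<phi> (1 / norm y) \<le> \<phi> (2 / norm y * 1)"
    using y by (intro \<phi>_le) (auto simp: divide_simps)
  also have "\<dots> \<le> \<kappa> * (2 / norm y) powr \<beta> * \<phi> 1"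
    using y by (intro \<phi>_scaling) auto
  also have "\<dots> \<le> \<kappa> * (2 / norm y) powr \<alpha> * \<phi> 1"
    using y exponents \<kappa>_pos \<phi>_pos[of 1] by (intro mult_mono powr_mono) auto
  also have "(2 / norm y) powr \<alpha> = 2 powr \<alpha> * norm y powr - \<alpha>"
    using y by (simp add: powr_divide powr_minus_divide)
  finally have "\<phi> (1 / norm y) * norm y powr - real DIM('a)
      \<le> \<kappa> * (2 powr \<alpha> * norm y powr - \<alpha>) * \<phi> 1 * norm y powr - real DIM('a)"
    by (intro mult_right_mono) auto
  also have "\<dots> = \<kappa> * 2 powr \<alpha> * \<phi> 1 * norm y powr - (real DIM('a) + \<alpha>)"
    by (simp add: powr_add powr_diff powr_minus_divide)
  finally show "kern y \<le> C * norm y powr - (real DIM('a) + \<alpha>)"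
    using kern_eq[OF y(1)] by (simp add: C_def algebra_simps)
qed

section \<open>Comparison of the kernel with the weights of the normalisation\<close>

lemma weight_nonneg: "0 \<le> weight z"
proof (cases "z = 0")
  case False
  then show ?thesis
    using \<phi>_pos[of "1 / norm z"] by (auto simp: weight_def intro!: divide_nonneg_nonneg add_nonneg_nonneg mult_nonneg_nonneg)
qed (simp add: weight_def)

lemma weight_le_2: "weight z \<le> 2"
proof (cases "z = 0")
  case False
  then have "0 \<le> norm z ^ DIM('a) * inverse (\<phi> (1 / norm z))"
    using \<phi>_pos[of "1 / norm z"] by (intro mult_nonneg_nonneg) auto
  then have "1 / (1 + norm z ^ DIM('a) * inverse (\<phi> (1 / norm z))) \<le> 1"
    by simp
  moreover have "1 / (1 + norm z powr (real DIM('a) + \<alpha>)) \<le> 1"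
  proof -
    have "0 \<le> norm z powr (real DIM('a) + \<alpha>)" by (rule powr_ge_zero)
    then have "1 \<le> 1 + norm z powr (real DIM('a) + \<alpha>)" by linarith
    then show ?thesis by (metis divide_le_eq_1_pos less_le_trans zero_less_one)
  qed
  ultimately show ?thesis by (simp add: weight_def)
qed (simp add: weight_def power_0_left)

lemma weight_ge_first: "1 / (1 + norm z powr (real DIM('a) + \<alpha>)) \<le> weight (z::'a::euclidean_space)"
proof (cases "z = 0")
  case False
  then show ?thesis
    using \<phi>_pos[of "1 / norm z"] by (auto simp: weight_def intro!: divide_nonneg_nonneg add_nonneg_nonneg mult_nonneg_nonneg)
qed (simp add: weight_def)

lemma weight_ge_half: 
  assumes "norm (z::'a::euclidean_space) \<le> 1"
  shows "1 / 2 \<le> weight z"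
proof -
  have "norm z powr (real DIM('a) + \<alpha>) \<le> 1 powr (real DIM('a) + \<alpha>)"
    using assms \<alpha>_pos by (intro powr_mono2) auto
  then have "1 / 2 \<le> 1 / (1 + norm z powr (real DIM('a) + \<alpha>))"
    by (intro divide_left_mono) (auto intro!: add_pos_nonneg mult_pos_pos)
  then show ?thesis using weight_ge_first[of z] by linarith
qed

text \<open>Away from the unit ball the weight has the shape of the kernel. With
  \<open>f = \<phi> (1 / norm z)\<close> and \<open>n = norm z ^ DIM('a)\<close> the second weight
  is \<open>f / (f + n)\<close>; it is comparable to \<open>f / n\<close> because
  \<open>f \<le> \<phi> 1\<close> and \<open>1 \<le> n\<close>.\<close>

lemma weight_far:
  fixes z :: "'a::euclidean_space"
  assumes z: "1 \<le> norm z"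
  shows "weight z \<le> norm z powr - (real DIM('a) + \<alpha>) + \<phi> (1 / norm z) * norm z powr - real DIM('a)"
    and "norm z powr - (real DIM('a) + \<alpha>) + \<phi> (1 / norm z) * norm z powr - real DIM('a) \<le> (2 + \<phi> 1) * weight z"
proof -
  define n where "n = norm z powr real DIM('a)"
  define m where "m = norm z powr (real DIM('a) + \<alpha>)"
  define f where "f = \<phi> (1 / norm z)"
  have z0: "norm z > 0" using z by linarith
  have f: "f > 0" "f \<le> \<phi> 1" unfolding f_def using z z0 by (auto intro!: \<phi>_pos \<phi>_le)
  have n: "n \<ge> 1" and m: "m \<ge> 1" unfolding n_def m_def using z \<alpha>_pos by (auto intro!: ge_one_powr_ge_zero)
  have w: "weight z = 1 / (1 + m) + f / (f + n)"
    using f n z z0 by (simp add: weight_def m_def f_def n_def powr_realpow divide_simps)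
  have r: "norm z powr - (real DIM('a) + \<alpha>) = 1 / m" "norm z powr - real DIM('a) = 1 / n"
    by (simp_all only: m_def n_def powr_minus_divide)
  have "1 / (1 + m) \<le> 1 / m" "f / (f + n) \<le> f * (1 / n)"
    using m n f by (auto simp: divide_simps)
  then show "weight z \<le> norm z powr - (real DIM('a) + \<alpha>) + \<phi> (1 / norm z) * norm z powr - real DIM('a)"
    unfolding w r f_def[symmetric] by linarith
  have "1 / m \<le> (2 + \<phi> 1) * (1 / (1 + m))"
  proof -
    have "1 + m \<le> 2 * m" using m by simp
    also have "\<dots> \<le> (2 + \<phi> 1) * m" using m f by (intro mult_right_mono) auto
    finally show ?thesis using m by (simp add: field_simps)
  qed
  moreover have "f * (1 / n) \<le> (2 + \<phi> 1) * (f / (f + n))"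
  proof -
    have "f + n \<le> (2 + \<phi> 1) * n"
      using mult_mono[of f "\<phi> 1" 1 n] f n by (simp add: algebra_simps)
    then have "1 / n \<le> (2 + \<phi> 1) * (1 / (f + n))"
      using f n by (simp add: field_simps)
    then show ?thesis using f mult_left_mono[of "1 / n" "(2 + \<phi> 1) * (1 / (f + n))" f] by (simp add: mult.commute)
  qed
  ultimately show "norm z powr - (real DIM('a) + \<alpha>) + \<phi> (1 / norm z) * norm z powr - real DIM('a) \<le> (2 + \<phi> 1) * weight z"
    unfolding w r f_def[symmetric] by (simp add: distrib_left)
qed

lemma \<phi>_doubling: "0 < t \<Longrightarrow> \<phi> (2 * t) \<le> \<kappa> * 4 * \<phi> t"
proof -
  assume t: "0 < t"
  have "\<phi> (2 * t) \<le> \<kappa> * 2 powr \<beta> * \<phi> t" by (intro \<phi>_scaling t) auto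
  also have "\<dots> \<le> \<kappa> * 2 powr 2 * \<phi> t"
    using exponents \<kappa>_pos \<phi>_pos[OF t] by (intro mult_mono powr_mono) auto
  finally show ?thesis by simp
qed

text \<open>For \<open>norm y \<le> 2\<close> the weight at \<open>x + y\<close> is bounded below
  and the kernel is at most a multiple of \<open>r powr - p\<close>; for larger \<open>y\<close> the
  norms of \<open>y\<close> and \<open>x + y\<close> are comparable and \<open>weight_far\<close>
  applies. Multiplied by \<open>u (x + y)\<close> and integrated, this bounds the tail of a
  normalised \<open>u\<close> by a multiple of \<open>r powr - p\<close>.\<close>

lemma kern_le_weight:
  obtains C where "0 < C" "\<And>r x (y::'a::euclidean_space). 0 < r \<Longrightarrow> r \<le> 1 \<Longrightarrow> r \<le> norm y \<Longrightarrow> norm x \<le> 1 \<Longrightarrow>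
    kern y \<le> C * r powr - (real DIM('a) + \<alpha>) * weight (x + y)"
proof -
  define p where "p = real DIM('a) + \<alpha>"
  have p: "p > 0" using \<alpha>_pos by (simp add: p_def add_pos_pos)
  obtain C1 where C1: "0 < C1" "\<And>y::'a. y \<noteq> 0 \<Longrightarrow> norm y \<le> 2 \<Longrightarrow> kern y \<le> C1 * norm y powr - p"
    unfolding p_def using kern_le by blast
  define C2 where "C2 = (2 * 2 powr p + \<kappa> * 4 * 2 powr real DIM('a)) * (2 + \<phi> 1)"
  define C where "C = C1 * (1 + 3 powr p) + C2"
  have C2: "C2 > 0" using \<phi>_pos[of 1] \<kappa>_pos by (simp add: C2_def add_pos_pos)
  have C: "C > 0" using C1 C2 by (simp add: C_def add_pos_pos)
  show ?thesis
  proof (rule that[OF C], fold p_def)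
    fix r and x y :: 'a
    assume r: "0 < r" "r \<le> 1" "r \<le> norm y" and x: "norm x \<le> 1"
    define z where "z = x + y"
    have rp: "r powr - p \<ge> 1"
      using powr_mono2'[of "-p" r 1] p r by simp
    have y0: "y \<noteq> 0" using r by auto
    show "kern y \<le> C * r powr - p * weight (x + y)"
    proof (cases "norm y \<le> 2")
      case True
      have "norm z \<le> 3" unfolding z_def using norm_triangle_ineq[of x y] x True by linarith
      then have "norm z powr p \<le> 3 powr p" using p by (intro powr_mono2) auto
      then have "1 / (1 + 3 powr p) \<le> 1 / (1 + norm z powr p)"
        by (intro divide_left_mono) (auto intro!: add_pos_nonneg mult_pos_pos)
      also have "\<dots> \<le> weight z" unfolding p_def by (rule weight_ge_first)
      finally have w: "1 \<le> (1 + 3 powr p) * weight z"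
        using add_pos_nonneg[of 1 "3 powr p"] by (simp add: field_simps)
      have "kern y \<le> C1 * norm y powr - p" using C1(2)[OF y0 True] .
      also have "\<dots> \<le> C1 * r powr - p"
        using C1 r p by (intro mult_left_mono powr_mono2') auto
      also have "\<dots> \<le> C1 * r powr - p * ((1 + 3 powr p) * weight z)"
        using mult_left_mono[OF w, of "C1 * r powr - p"] C1(1)
        by (simp only: mult_1_right) (simp add: less_imp_le)
      also have "\<dots> = (C1 * (1 + 3 powr p)) * (r powr - p * weight z)" by simp
      also have "\<dots> \<le> C * (r powr - p * weight z)"
        unfolding C_def using C2 weight_nonneg[of z] by (intro mult_right_mono) auto
      finally show ?thesis by (simp add: z_def)
    next
      case False
      then have y2: "norm y > 2" by simp
      have z1: "1 \<le> norm z" and zy: "norm z / 2 \<le> norm y"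
        using y2 x norm_triangle_ineq[of x y] norm_triangle_ineq4[of z x] unfolding z_def
        by (auto simp: algebra_simps)
      have z0: "norm z > 0" using z1 by linarith
      have a: "norm y powr - p \<le> 2 powr p * norm z powr - p"
      proof -
        have "norm y powr - p \<le> (norm z / 2) powr - p" using z0 zy p by (intro powr_mono2') auto
        then show ?thesis using z0 by (simp add: powr_divide powr_minus_divide)
      qed
      have b: "norm y powr - real DIM('a) \<le> 2 powr real DIM('a) * norm z powr - real DIM('a)"
      proof -
        have "norm y powr - real DIM('a) \<le> (norm z / 2) powr - real DIM('a)"
          using z0 zy by (intro powr_mono2') auto
        then show ?thesis using z0 by (simp add: powr_divide powr_minus_divide)
      qed
      have "\<phi> (1 / norm y) \<le> \<phi> (2 * (1 / norm z))"
        using z0 zy y0 by (intro \<phi>_le) (auto simp: field_simps)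
      also have "\<dots> \<le> \<kappa> * 4 * \<phi> (1 / norm z)" using z0 by (intro \<phi>_doubling) auto
      finally have c: "\<phi> (1 / norm y) \<le> \<kappa> * 4 * \<phi> (1 / norm z)" .
      have pz: "\<phi> (1 / norm z) > 0" "\<phi> (1 / norm y) > 0" using z0 y0 by (auto intro: \<phi>_pos)
      have "kern y = (2 - \<alpha>) * norm y powr - p + \<phi> (1 / norm y) * norm y powr - real DIM('a)"
        unfolding p_def by (rule kern_eq[OF y0])
      also have "\<dots> \<le> 2 * (2 powr p * norm z powr - p)
          + (\<kappa> * 4 * \<phi> (1 / norm z)) * (2 powr real DIM('a) * norm z powr - real DIM('a))"
        using a b c exponents \<kappa>_pos pz by (intro add_mono mult_mono) auto
      also have "\<dots> \<le> (2 * 2 powr p + \<kappa> * 4 * 2 powr real DIM('a))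
          * (norm z powr - p + \<phi> (1 / norm z) * norm z powr - real DIM('a))"
        using pz \<kappa>_pos by (simp add: algebra_simps)
      also have "\<dots> \<le> (2 * 2 powr p + \<kappa> * 4 * 2 powr real DIM('a)) * ((2 + \<phi> 1) * weight z)"
        using weight_far(2)[OF z1] \<kappa>_pos unfolding p_def
        by (intro mult_left_mono) (auto intro!: add_nonneg_nonneg)
      also have "\<dots> = C2 * (1 * weight z)" by (simp add: C2_def)
      also have "\<dots> \<le> C * (r powr - p * weight z)"
        unfolding C_def using C1 C2 weight_nonneg[of z] rp by (intro mult_mono) (auto intro!: add_nonneg_nonneg mult_nonneg_nonneg)
      finally show ?thesis by (simp add: z_def)
    qed
  qed
qed

text \<open>If \<open>x + y\<close> lies in the unit ball, then \<open>norm y \<le> 2\<close> and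
  the kernel is bounded below while the weight is at most 2. Otherwise
  \<open>norm y \<le> 2 * norm (x + y)\<close>, and doubling transfers \<open>\<phi>\<close> between
  the two scales. Hence the whole mass of \<open>u\<close> is visible from every \<open>x\<close> in
  the unit ball.\<close>

lemma kern_ge_weight:
  obtains c where "0 < c" "\<And>x (y::'a::euclidean_space). y \<noteq> 0 \<Longrightarrow> norm x \<le> 1 \<Longrightarrow> c * weight (x + y) \<le> kern y"
proof -
  define p where "p = real DIM('a) + \<alpha>"
  have p: "p > 0" using \<alpha>_pos by (simp add: p_def add_pos_pos)
  define c1 where "c1 = (2 - \<alpha>) * 2 powr - p"
  define c2 where "c2 = 2 powr - real DIM('a) / (\<kappa> * 4)"
  define c where "c = min (c1 / 2) c2"
  have c1: "c1 > 0" and c2: "c2 > 0" using exponents \<kappa>_pos by (auto simp: c1_def c2_def)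
  have c: "c > 0" "c \<le> c1 / 2" "c \<le> c2" using c1 c2 by (auto simp: c_def)
  show ?thesis
  proof (rule that[OF c(1)])
    fix x y :: 'a
    assume y: "y \<noteq> 0" and x: "norm x \<le> 1"
    define z where "z = x + y"
    show "c * weight (x + y) \<le> kern y"
    proof (cases "norm z \<le> 1")
      case True
      then have "norm y \<le> 2" unfolding z_def using norm_triangle_ineq4[of "x + y" x] x by simp
      then have "2 powr - p \<le> norm y powr - p" using y p by (intro powr_mono2') auto
      then have "c1 \<le> (2 - \<alpha>) * norm y powr - p" unfolding c1_def using exponents by (intro mult_left_mono) auto
      also have "\<dots> \<le> kern y" unfolding p_def by (rule kern_ge[OF y])
      finally have "c1 \<le> kern y" .
      moreover have "c * weight z \<le> c1 / 2 * 2"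
        using c c1 weight_le_2[of z] weight_nonneg[of z] by (intro mult_mono) auto
      ultimately show ?thesis by (simp add: z_def)
    next
      case False
      then have z1: "1 \<le> norm z" and z0: "norm z > 0" by auto
      have yz: "norm y \<le> 2 * norm z"
        unfolding z_def using norm_triangle_ineq4[of "x + y" x] x z1 by (simp add: z_def)
      have a: "2 powr - p * norm z powr - p \<le> norm y powr - p"
        using powr_mono2'[of "-p" "norm y" "2 * norm z"] y yz p z0 by (simp add: powr_mult)
      have b: "2 powr - real DIM('a) * norm z powr - real DIM('a) \<le> norm y powr - real DIM('a)"
        using powr_mono2'[of "- real DIM('a)" "norm y" "2 * norm z"] y yz z0 by (simp add: powr_mult)
      have "\<phi> (1 / norm z) = \<phi> (2 * (1 / (2 * norm z)))" by simp
      also have "\<dots> \<le> \<kappa> * 4 * \<phi> (1 / (2 * norm z))" using z0 by (intro \<phi>_doubling) auto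
      also have "\<dots> \<le> \<kappa> * 4 * \<phi> (1 / norm y)"
        using z0 yz y \<kappa>_pos by (intro mult_left_mono \<phi>_le) (auto simp: divide_simps)
      finally have d: "\<phi> (1 / norm z) / (\<kappa> * 4) \<le> \<phi> (1 / norm y)"
        using \<kappa>_pos by (simp add: field_simps)
      have pz: "\<phi> (1 / norm z) > 0" "\<phi> (1 / norm y) > 0" using z0 y by (auto intro: \<phi>_pos)
      have "c * weight z \<le> c * (norm z powr - p + \<phi> (1 / norm z) * norm z powr - real DIM('a))"
        unfolding p_def using weight_far(1)[OF z1] c by (intro mult_left_mono) auto
      also have "\<dots> \<le> c1 * norm z powr - p + c2 * (\<phi> (1 / norm z) * norm z powr - real DIM('a))"
        unfolding distrib_left using c c1 pz by (intro add_mono mult_right_mono) auto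
      also have "\<dots> = (2 - \<alpha>) * (2 powr - p * norm z powr - p)
           + (\<phi> (1 / norm z) / (\<kappa> * 4)) * (2 powr - real DIM('a) * norm z powr - real DIM('a))"
        by (simp add: c1_def c2_def)
      also have "\<dots> \<le> (2 - \<alpha>) * norm y powr - p + \<phi> (1 / norm y) * norm y powr - real DIM('a)"
        using a b d exponents pz \<kappa>_pos by (intro add_mono mult_mono mult_left_mono) auto
      also have "\<dots> = kern y" unfolding p_def by (rule kern_eq[OF y, symmetric])
      finally show ?thesis by (simp add: z_def)
    qed
  qed
qed

section \<open>Measurability of the kernel and its integrability at infinity\<close>

lemma kern_measurable [measurable]: "kern \<in> borel_measurable (borel :: 'a::euclidean_space measure)"
proof -
  \<comment> \<open>Monotonicity of \<open>\<phi>\<close> is known only on positive arguments;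
    extended by 0 it becomes monotone on the whole line, hence Borel.\<close>
  define g where "g t = (if t > 0 then \<phi> t else 0)" for t
  have "mono g" unfolding g_def
    by (intro monoI) (auto intro: \<phi>_le less_imp_le[OF \<phi>_pos])
  then have [measurable]: "g \<in> borel_measurable borel" by (rule borel_measurable_mono)
  have "kern = (\<lambda>y::'a. ((2 - \<alpha>) / norm y powr \<alpha> + g (1 / norm y)) / norm y ^ DIM('a))"
    by (rule ext) (auto simp: kern_def g_def)
  then show ?thesis by simp
qed

text \<open>On the interval from \<open>1 / 2 ^ Suc k\<close> to \<open>1 / 2 ^ k\<close>
  monotonicity gives \<open>\<phi> y / y \<ge> \<phi> (1 / 2 ^ Suc k) * 2 ^ k\<close>, and the
  interval has length \<open>1 / 2 ^ Suc k\<close>. So each interval contributes at least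
  \<open>\<phi> (1 / 2 ^ Suc k) / 2\<close> to the Dini integral.\<close>

lemma summable_\<phi>_dyadic: "summable (\<lambda>k. \<phi> (1 / 2 ^ k))"
proof -
  \<comment> \<open>The dyadic intervals are obtained as successive differences of this increasing
    family, which yields their disjointness.\<close>
  define A where "A n = {1 / 2 ^ n ..< 1::real}" for n :: nat
  define g where "g y = indicator {0<..<1} y * (\<phi> y / y)" for y :: real
  have g0: "g y \<ge> 0" for y by (auto simp: g_def indicator_def intro!: divide_nonneg_nonneg intro: less_imp_le[OF \<phi>_pos])
  have int: "integrable lebesgue g"
    using \<phi>_dini by (simp add: g_def[abs_def] set_integrable_def)
  have disj: "disjoint_family (\<lambda>i. A (Suc i) - A i)"
  proof (rule disjoint_family_Suc)
    fix n
    have "(1::real) / 2 ^ Suc n \<le> 1 / 2 ^ n" by (simp add: field_simps)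
    then show "A n \<subseteq> A (Suc n)"
      unfolding A_def by (intro ivl_subset[THEN iffD2] disjI2) auto
  qed
  have AS: "A (Suc k) - A k = {1 / 2 ^ Suc k ..< 1 / 2 ^ k}" for k
  proof -
    have "{l..<1} - {m..<1} = {l..<m}" if "m \<le> (1::real)" for l m
      using that by auto
    then show ?thesis unfolding A_def by simp
  qed
  have "(\<Sum>k. ennreal (\<phi> (1 / 2 ^ Suc k) / 2)) \<le> (\<Sum>k. \<integral>\<^sup>+ y. ennreal (g y) * indicator (A (Suc k) - A k) y \<partial>lebesgue)"
  proof (rule suminf_le)
    fix k
    have "\<phi> (1 / 2 ^ Suc k) * 2 ^ k \<le> g y" if "y \<in> {1 / 2 ^ Suc k ..< 1 / 2 ^ k}" for y
    proof -
      have y: "0 < y" "y < 1" "1 / y \<ge> 2 ^ k" "1 / 2 ^ Suc k \<le> y"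
      proof -
        have "(0::real) < 1 / 2 ^ Suc k" by simp
        with that show "0 < y" "1 / 2 ^ Suc k \<le> y" by auto
        have "y < 1 / 2 ^ k" using that by simp
        also have "\<dots> \<le> 1" by simp
        finally show "y < 1" .
        show "1 / y \<ge> 2 ^ k" using that \<open>0 < y\<close> by (simp add: field_simps)
      qed
      have "\<phi> (1 / 2 ^ Suc k) * 2 ^ k \<le> \<phi> y * (1 / y)"
        using y by (intro mult_mono \<phi>_le) (auto intro: less_imp_le[OF \<phi>_pos])
      then show ?thesis using y by (simp add: g_def)
    qed
    then have "(\<integral>\<^sup>+ y. ennreal (\<phi> (1 / 2 ^ Suc k) * 2 ^ k) * indicator {1 / 2 ^ Suc k ..< 1 / 2 ^ k :: real} y \<partial>lebesgue)
      \<le> (\<integral>\<^sup>+ y. ennreal (g y) * indicator {1 / 2 ^ Suc k ..< 1 / 2 ^ k :: real} y \<partial>lebesgue)"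
      by (intro nn_integral_mono) (auto simp: indicator_def intro!: ennreal_leI)
    moreover have "(\<integral>\<^sup>+ y. ennreal (\<phi> (1 / 2 ^ Suc k) * 2 ^ k) * indicator {1 / 2 ^ Suc k ..< 1 / 2 ^ k :: real} y \<partial>lebesgue)
      = ennreal (\<phi> (1 / 2 ^ Suc k) / 2)"
    proof -
      have "(1::real) / 2 ^ Suc k \<le> 1 / 2 ^ k" by (simp add: field_simps)
      moreover have "\<phi> (1 / 2 ^ Suc k) * 2 ^ k * (1 / 2 ^ k - 1 / 2 ^ Suc k) = \<phi> (1 / 2 ^ Suc k) / 2"
        by (simp add: field_simps)
      ultimately show ?thesis
        using less_imp_le[OF \<phi>_pos, of "1 / 2 ^ Suc k"]
        by (simp add: nn_integral_cmult_indicator flip: ennreal_mult')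
    qed
    ultimately show "ennreal (\<phi> (1 / 2 ^ Suc k) / 2) \<le> (\<integral>\<^sup>+ y. ennreal (g y) * indicator (A (Suc k) - A k) y \<partial>lebesgue)"
      unfolding AS by simp
  qed auto
  also have "\<dots> = (\<integral>\<^sup>+ y. (\<Sum>k. ennreal (g y) * indicator (A (Suc k) - A k) y) \<partial>lebesgue)"
    using borel_measurable_integrable[OF int]
    by (intro nn_integral_suminf[symmetric] borel_measurable_times_ennreal borel_measurable_indicator
        measurable_compose[OF _ measurable_ennreal]) (auto simp: A_def)
  also have "\<dots> = (\<integral>\<^sup>+ y. ennreal (g y) * indicator (\<Union>k. A (Suc k) - A k) y \<partial>lebesgue)"
    using suminf_indicator[OF disj] by simp
  also have "\<dots> \<le> (\<integral>\<^sup>+ y. ennreal (g y) \<partial>lebesgue)"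
    by (intro nn_integral_mono) (auto simp: indicator_def)
  also have "\<dots> < \<infinity>"
    using int g0 by (simp add: nn_integral_eq_integral)
  finally have "summable (\<lambda>k. \<phi> (1 / 2 ^ Suc k) / 2)"
    by (intro summable_suminf_not_top) (auto intro: less_imp_le[OF \<phi>_pos])
  then have "summable (\<lambda>k. \<phi> (1 / 2 ^ Suc k))"
    using summable_mult[of "\<lambda>k. \<phi> (1 / 2 ^ Suc k) / 2" 2] by simp
  then show ?thesis by (subst (asm) summable_Suc_iff)
qed

text \<open>On the shell from \<open>2 ^ k\<close> to \<open>2 ^ Suc k\<close> the kernel is at most
  \<open>h k / (2 ^ k) ^ DIM('a)\<close>, and the volume of the enclosing ball cancels the
  denominator up to a constant. What remains is the sum of \<open>h\<close>: a geometric series plus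
  the dyadic form of the Dini condition.\<close>

lemma kern_integrable_far:
  "integrable lebesgue (\<lambda>y::'a::euclidean_space. indicator (- ball 0 1) y * kern y)"
proof -
  define V where "V = unit_ball_vol DIM('a)"
  have V: "V > 0" unfolding V_def by simp
  define h where "h k = (2 - \<alpha>) * (2 powr - \<alpha>) ^ k + \<phi> (1 / 2 ^ k)" for k :: nat
  have h0: "h k \<ge> 0" for k
    unfolding h_def using exponents by (intro add_nonneg_nonneg) (auto intro: less_imp_le[OF \<phi>_pos])
  have sh: "summable h"
  proof -
    have "2 powr - \<alpha> < 2 powr 0" using \<alpha>_pos by (intro powr_less_mono) auto
    then show ?thesis unfolding h_def[abs_def]
      by (intro summable_add summable_mult summable_geometric summable_\<phi>_dyadic) auto
  qed
  define F where "F = (\<lambda>y::'a. indicator (- ball 0 1) y * kern y)"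
  have F0: "F y \<ge> 0" for y by (simp add: F_def kern_nonneg)
  have "\<exists>k::nat. y \<in> ball 0 (2 ^ Suc k) \<and> ennreal (F y) \<le> ennreal (h k / (2 ^ k) ^ DIM('a))"
    if "ennreal (F y) \<noteq> 0" for y
  proof -
    have "1 \<le> norm y"
    proof (rule ccontr)
      assume "\<not> 1 \<le> norm y"
      then have "F y = 0" by (simp add: F_def)
      then show False using that by simp
    qed
    then obtain k :: nat where k: "2 ^ k \<le> norm y" "norm y < 2 ^ Suc k" using dyadic_scale by blast
    have y0: "norm y > 0" using \<open>1 \<le> norm y\<close> by linarith
    have "F y \<le> kern y" by (auto simp: F_def indicator_def kern_nonneg)
    also have "kern y \<le> h k / (2 ^ k) ^ DIM('a)"
    proof -
      have "norm y powr - \<alpha> \<le> (2 ^ k) powr - \<alpha>" using k \<alpha>_pos by (intro powr_mono2') auto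
      also have "(2 ^ k) powr - \<alpha> = (2 powr - \<alpha>) ^ k"
        by (simp add: powr_powr mult.commute flip: powr_realpow)
      finally have a: "(2 - \<alpha>) / norm y powr \<alpha> \<le> (2 - \<alpha>) * (2 powr - \<alpha>) ^ k"
        using exponents by (simp add: powr_minus_divide mult_left_mono divide_inverse)
      have b: "\<phi> (1 / norm y) \<le> \<phi> (1 / 2 ^ k)"
        using k y0 by (intro \<phi>_le) (auto simp: divide_simps)
      show ?thesis unfolding kern_def
        using k a b h0[of k] unfolding h_def by (intro frac_le add_mono power_mono) auto
    qed
    finally show ?thesis using k by (auto intro!: exI[of _ k] ennreal_leI)
  qed
  then have "(\<integral>\<^sup>+ y. ennreal (F y) \<partial>lebesgue) \<le> (\<Sum>k. ennreal (h k / (2 ^ k) ^ DIM('a)) * emeasure lebesgue (ball (0::'a) (2 ^ Suc k)))"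
    by (rule nn_integral_le_suminf_cover) auto
  also have "\<dots> = (\<Sum>k. ennreal (V * 2 ^ DIM('a) * h k))"
  proof (rule arg_cong[where f=suminf], rule ext)
    fix k
    have "h k / (2 ^ k) ^ DIM('a) * (V * (2 ^ Suc k) ^ DIM('a)) = V * 2 ^ DIM('a) * h k"
      by (simp add: power_mult_distrib)
    then show "ennreal (h k / (2 ^ k) ^ DIM('a)) * emeasure lebesgue (ball (0::'a) (2 ^ Suc k)) = ennreal (V * 2 ^ DIM('a) * h k)"
      using h0[of k] by (subst ball_lebesgue_measure) (auto simp: V_def simp flip: ennreal_mult')
  qed
  also have "\<dots> < top"
    by (intro top.not_eq_extremum[THEN iffD1] ennreal_suminf_neq_top summable_mult sh mult_nonneg_nonneg h0)
      (use V in auto)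
  finally have fin: "(\<integral>\<^sup>+ y. ennreal (F y) \<partial>lebesgue) < \<infinity>" by simp
  have "F \<in> borel_measurable lborel" unfolding F_def by measurable
  then have "F \<in> borel_measurable lebesgue" by (rule measurable_completion)
  then show ?thesis using fin F0 unfolding F_def[symmetric] by (intro integrableI_nonneg) auto
qed

lemma kern_minus [simp]: "kern (- y) = kern y"
  by (simp add: kern_def)

section \<open>Estimates for subsolutions\<close>

text \<open>The centre \<open>z0\<close> is independent of the contact point \<open>x\<close>, since
  the second difference of a paraboloid does not see it. The bound may omit \<open>y = 0\<close>, a
  null set, where negative powers of the norm take default values.\<close>

lemma subsolution_test:
  fixes w :: "'a::euclidean_space \<Rightarrow> real"
  assumes visc: "viscosity_subsolution (Mplus lam Lam \<alpha> \<phi>) w g U"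
    and \<epsilon>: "0 < \<epsilon>" "cball x \<epsilon> \<subseteq> U"
    and touch: "\<And>z. z \<in> ball x \<epsilon> \<Longrightarrow> w z \<le> c + P * (norm (z - z0))\<^sup>2"
      "w x = c + P * (norm (x - z0))\<^sup>2"
    and H: "integrable lebesgue H"
    and bound: "\<And>y. y \<noteq> 0 \<Longrightarrow>
      pucci_fun (second_diff (\<lambda>z. if z \<in> ball x \<epsilon> then c + P * (norm (z - z0))\<^sup>2 else w z) x y) * kern y \<le> H y"
  shows "g x \<le> integral\<^sup>L lebesgue H"
proof -
  let ?v = "\<lambda>z. if z \<in> ball x \<epsilon> then c + P * (norm (z - z0))\<^sup>2 else w z"
  have "x \<in> U" using \<epsilon> by auto
  have "ereal (g x) \<le> Mplus lam Lam \<alpha> \<phi> ?v x"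
    using visc[unfolded viscosity_subsolution_def, rule_format, OF \<open>x \<in> U\<close>,
        of "ball x \<epsilon>" "\<lambda>z. c + P * (norm (z - z0))\<^sup>2"]
      \<epsilon> touch by (simp add: C2_on_paraboloid)
  also have "\<dots> \<le> ereal (integral\<^sup>L lebesgue H)"
    unfolding Mplus_eq
  proof (rule ext_integral_upper_bound[OF H])
    have "AE y in lebesgue. y \<noteq> (0::'a)"
      by (intro AE_completion AE_lborel_singleton)
    then show "AE y in lebesgue. pucci_fun (second_diff ?v x y) * kern y \<le> H y"
      by (rule eventually_mono) (rule bound)
  qed
  finally show ?thesis by simp
qed

lemma normalised_weight:
  fixes u :: "'a::euclidean_space \<Rightarrow> real"
  assumes "normalised \<alpha> \<phi> u"
  shows "integrable lebesgue (\<lambda>z. u z * weight z)" "(LINT z|lebesgue. u z * weight z) = 1"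
  using assms unfolding normalised_def weight_def distrib_left by simp_all

text \<open>By Markov, the points of a ball of radius \<open>s\<close> with \<open>u > L / 2\<close>
  have measure at most a multiple of \<open>1 / L\<close>, which is negligible against
  \<open>s ^ d\<close> when \<open>L * s ^ d\<close> is large. This dictates the exponent
  \<open>d\<close> in the weighted maximum, \<open>s\<close> being a fixed multiple of the distance
  to the sphere of radius 15/16. On \<open>cball 0 (7/8)\<close> that distance is at least 1/16,
  hence the factor \<open>16 ^ d\<close>.\<close>

lemma local_upper_bound:
  obtains \<delta> M where "0 < \<delta>" "0 < M"
    "\<And>\<Omega> (u :: 'a::euclidean_space \<Rightarrow> real) g. open \<Omega> \<Longrightarrow> continuous_on (ball 0 1) u \<Longrightarrow>
      (\<And>x. 0 \<le> u x) \<Longrightarrow> (\<And>x. x \<in> ball 0 1 - \<Omega> \<Longrightarrow> u x = 0) \<Longrightarrow> normalised \<alpha> \<phi> u \<Longrightarrow>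
      viscosity_subsolution (Mplus lam Lam \<alpha> \<phi>) u g (ball 0 1 \<inter> \<Omega>) \<Longrightarrow> (\<And>x. - \<delta> \<le> g x) \<Longrightarrow>
      \<forall>x\<in>cball 0 (7/8). u x \<le> M"
proof -
  define d where "d = DIM('a)"
  define p where "p = real d + \<alpha>"
  define V where "V = unit_ball_vol d"
  have d: "d > 0" by (simp add: d_def)
  have p: "p > 0" using \<alpha>_pos by (simp add: p_def)
  have V: "V > 0" by (simp add: V_def)
  obtain C1 where C1: "0 < C1" "\<And>y::'a. y \<noteq> 0 \<Longrightarrow> norm y \<le> 2 \<Longrightarrow> kern y \<le> C1 * norm y powr - p"
    unfolding p_def d_def using kern_le by blast
  obtain C3 where C3: "0 < C3" "\<And>r x (y::'a). 0 < r \<Longrightarrow> r \<le> 1 \<Longrightarrow> r \<le> norm y \<Longrightarrow> norm x \<le> 1 \<Longrightarrow>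
    kern y \<le> C3 * r powr - p * weight (x + y)"
    unfolding p_def d_def using kern_le_weight by blast
  obtain C5 where C5: "0 < C5"
    "\<And>r. 0 < r \<Longrightarrow> integrable lebesgue (\<lambda>y::'a. indicator (ball 0 r) y * ((norm y)\<^sup>2 * norm y powr - p))"
    "\<And>r. 0 < r \<Longrightarrow> (LINT y|lebesgue. indicator (ball (0::'a) r) y * ((norm y)\<^sup>2 * norm y powr - p)) \<le> C5 * r powr (2 - \<alpha>)"
    using integrable_radial_power[of p, where 'a='a] p exponents unfolding p_def d_def by auto
  \<comment> \<open>In units of \<open>L * s powr - \<alpha>\<close>, the gain from
    \<open>u \<le> L / 2\<close> is at least \<open>c2\<close>. \<open>A\<close> is chosen so that
    the paraboloid costs at most \<open>c2 / 4\<close>; the summands of \<open>B\<close> pay for the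
    points with \<open>u > L / 2\<close> and for the tail.\<close>
  define c2 where "c2 = lam * (2 - \<alpha>) * V / 2"
  have c2: "c2 > 0" unfolding c2_def using lam exponents V by simp
  define A where "A = c2 / (2 * Lam * C1 * C5)"
  have A: "A > 0" unfolding A_def using c2 Lam_pos C1 C5 by simp
  define B where "B = 4 * lam * (2 - \<alpha>) + Lam * C3"
  have B: "B > 0" unfolding B_def using lam Lam_pos exponents C3 by (simp add: add_pos_pos)
  \<comment> \<open>By Bernoulli, \<open>(1 - \<theta>) ^ d * (1 + A / 4) > 1\<close>: within
    distance \<open>\<theta> * d1\<close> of the maximum point, \<open>u\<close> stays below
    \<open>L * (1 + A / 4)\<close>.\<close>
  define \<theta> where "\<theta> = min (1/2) (A / 8 / (1 + A / 4) / d)"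
  have \<theta>: "0 < \<theta>" "\<theta> \<le> 1/2"
    using A d unfolding \<theta>_def by (simp_all only: min.cobounded1) simp
  have \<theta>A: "1 < (1 - \<theta>) ^ d * (1 + A / 4)"
  proof -
    have "\<theta> \<le> A / 8 / (1 + A / 4) / d" unfolding \<theta>_def by (rule min.cobounded2)
    then have "real d * \<theta> \<le> A / 8 / (1 + A / 4)"
      using d by (simp only: pos_le_divide_eq of_nat_0_less_iff) (simp add: mult.commute)
    then have "1 - A / 8 / (1 + A / 4) \<le> 1 + real d * (- \<theta>)" by simp
    also have "\<dots> \<le> (1 + - \<theta>) ^ d" using \<theta> by (intro Bernoulli_inequality) auto
    finally have "(1 - A / 8 / (1 + A / 4)) * (1 + A / 4) \<le> (1 - \<theta>) ^ d * (1 + A / 4)"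
      using A by (intro mult_right_mono) auto
    moreover have "(1 - A / 8 / (1 + A / 4)) * (1 + A / 4) = 1 + A / 8"
      using A by (simp add: field_simps)
    ultimately show ?thesis using A by linarith
  qed
  \<comment> \<open>The second entry makes the term with \<open>B\<close> at most another
    \<open>c2 / 4\<close> in the same units, the factor \<open>(2 / \<theta>) ^ d\<close> converting
    \<open>d1\<close> into \<open>s\<close>. The entry 1 ensures \<open>L \<ge> 1\<close>.\<close>
  define T0 where "T0 = max 1 (2 * B * (2 / \<theta>) ^ d * 4 / c2)"
  have T0: "1 \<le> T0" "2 * B * (2 / \<theta>) ^ d * 4 / c2 \<le> T0" unfolding T0_def by auto
  show ?thesis
  proof (rule that[of "c2 / 4" "T0 * 16 ^ d"])
    show "0 < c2 / 4" "0 < T0 * 16 ^ d" using c2 T0 by auto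
    fix \<Omega> and u :: "'a \<Rightarrow> real" and g
    assume \<Omega>: "open \<Omega>" and cont: "continuous_on (ball 0 1) u" and u0: "\<And>x. 0 \<le> u x"
      and vanish: "\<And>x. x \<in> ball 0 1 - \<Omega> \<Longrightarrow> u x = 0" and norm_u: "normalised \<alpha> \<phi> u"
      and visc: "viscosity_subsolution (Mplus lam Lam \<alpha> \<phi>) u g (ball 0 1 \<inter> \<Omega>)"
      and g: "\<And>x. - (c2 / 4) \<le> g x"
    define D where "D x = 15/16 - norm x" for x :: 'a
    have "\<exists>x\<in>cball 0 (15/16). \<forall>y\<in>cball 0 (15/16). u y * D y ^ d \<le> u x * D x ^ d"
      by (intro continuous_attains_sup continuous_intros continuous_on_subset[OF cont])
        (auto simp: D_def intro!: continuous_intros)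
    then obtain x1 where x1: "norm x1 \<le> 15/16"
      and x1_max: "\<And>y. norm y \<le> 15/16 \<Longrightarrow> u y * D y ^ d \<le> u x1 * D x1 ^ d"
      by (auto simp: dist_norm)
    have T: "u x1 * D x1 ^ d \<le> T0"
    proof (rule ccontr)
      assume "\<not> u x1 * D x1 ^ d \<le> T0"
      then have big: "T0 < u x1 * D x1 ^ d" by simp
      define L where "L = u x1"
      define d1 where "d1 = D x1"
      have d1: "0 < d1" "d1 \<le> 15/16"
      proof -
        have "D x1 \<noteq> 0" using big T0 d by (auto simp: power_0_left)
        then show "0 < d1" "d1 \<le> 15/16" using x1 by (auto simp: d1_def D_def)
      qed
      have LT: "T0 < L * d1 ^ d" using big by (simp add: L_def d1_def)
      have L1: "1 \<le> L"
      proof -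
        have "d1 ^ d \<le> 1" using d1 by (intro power_le_one) auto
        then have "L * d1 ^ d \<le> L * 1" using u0[of x1] unfolding L_def by (intro mult_left_mono) auto
        then show ?thesis using LT T0 by simp
      qed
      define s where "s = \<theta> * d1 / 2"
      have s: "0 < s" "s \<le> 1/4"
        using \<theta> d1 mult_mono[of \<theta> "1/2" d1 1] by (auto simp: s_def)
      have s2: "2 * s = \<theta> * d1" by (simp add: s_def)
      have in_ball: "norm x < 15/16" "(1 - \<theta>) * d1 \<le> D x" if "norm (x - x1) \<le> 2 * s" for x
      proof -
        have "norm x \<le> norm x1 + norm (x - x1)" by (metis norm_triangle_sub)
        then have "norm x \<le> norm x1 + \<theta> * d1" using that s2 by simp
        moreover have "(1 - \<theta>) * d1 = d1 - \<theta> * d1" by (simp add: left_diff_distrib)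
        ultimately show "(1 - \<theta>) * d1 \<le> D x" by (simp add: D_def d1_def)
        moreover have "(1 - \<theta>) * d1 > 0" using \<theta> d1 by simp
        ultimately show "norm x < 15/16" by (simp add: D_def)
      qed
      have u_le: "u x * (1 - \<theta>) ^ d \<le> L" if "norm (x - x1) \<le> 2 * s" for x
      proof -
        have "u x * ((1 - \<theta>) * d1) ^ d \<le> u x * D x ^ d"
          using in_ball[OF that] u0 \<theta> d1 by (intro mult_left_mono power_mono) auto
        also have "\<dots> \<le> L * d1 ^ d" using x1_max[of x] in_ball[OF that] by (simp add: L_def d1_def)
        finally have "(u x * (1 - \<theta>) ^ d) * d1 ^ d \<le> L * d1 ^ d" by (simp add: power_mult_distrib mult.assoc)
        then show ?thesis using d1 by simp
      qed
      \<comment> \<open>The paraboloid rises by \<open>A * L / 4\<close> at distance \<open>s\<close> from \<open>x1\<close>, more than \<open>u\<close> can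
        by the choice of \<open>\<theta>\<close>; hence the contact point is within \<open>s\<close> of \<open>x1\<close>.\<close>
      define P where "P = A * L / (2 * s)\<^sup>2"
      have P: "P > 0" unfolding P_def using A L1 s by simp
      define G where "G x = u x - P * (norm (x - x1))\<^sup>2" for x
      have "\<exists>x\<in>cball x1 (2 * s). \<forall>y\<in>cball x1 (2 * s). G y \<le> G x"
      proof (intro continuous_attains_sup)
        have "cball x1 (2 * s) \<subseteq> ball 0 1"
          using in_ball(1) by (force simp: dist_norm norm_minus_commute)
        then show "continuous_on (cball x1 (2 * s)) G"
          unfolding G_def by (intro continuous_intros continuous_on_subset[OF cont])
      qed (use s in auto)
      then obtain xs where xs: "norm (xs - x1) \<le> 2 * s"
        and xs_max: "\<And>y. norm (y - x1) \<le> 2 * s \<Longrightarrow> G y \<le> G xs"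
        unfolding Bex_def Ball_def mem_cball dist_norm norm_minus_commute[of x1] by blast
      have G1: "L \<le> G xs" using xs_max[of x1] s by (simp add: G_def L_def)
      have uxs: "L \<le> u xs" using G1 P by (simp add: G_def) (smt (verit) mult_nonneg_nonneg zero_le_power2)
      have xs_s: "norm (xs - x1) < s"
      proof (rule ccontr)
        assume "\<not> norm (xs - x1) < s"
        then have "P * s\<^sup>2 \<le> P * (norm (xs - x1))\<^sup>2" using s P by (intro mult_left_mono power_mono) auto
        moreover have "P * s\<^sup>2 = A * L / 4" using s by (simp add: P_def power_mult_distrib)
        ultimately have "L + A * L / 4 \<le> u xs" using G1 by (simp add: G_def)
        then have "(L * (1 + A / 4)) * (1 - \<theta>) ^ d \<le> u xs * (1 - \<theta>) ^ d"
          using \<theta> by (intro mult_right_mono) (auto simp: algebra_simps)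
        also have "\<dots> \<le> L" using u_le[OF xs] .
        finally have "L * ((1 - \<theta>) ^ d * (1 + A / 4)) \<le> L * 1" by (simp add: mult_ac)
        then show False using \<theta>A L1 by (simp add: mult_le_cancel_left)
      qed
      have xs1: "norm xs < 1" using in_ball(1)[OF xs] by simp
      \<comment> \<open>In the unit ball outside \<open>\<Omega>\<close> the function vanishes,
        whereas here \<open>u xs \<ge> L \<ge> 1\<close>.\<close>
      have "xs \<in> \<Omega>" using vanish[of xs] xs1 uxs L1 by (auto simp: dist_norm)
      then have "xs \<in> ball 0 1 \<inter> \<Omega>" using xs1 by simp
      then obtain e0 where e0: "e0 > 0" "cball xs e0 \<subseteq> ball 0 1 \<inter> \<Omega>"
        using open_contains_cball[of "ball 0 1 \<inter> \<Omega>"] \<Omega> by (metis open_Int open_ball)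
      \<comment> \<open>Inside this ball the test function is the paraboloid, and smallness of
        \<open>u\<close> gives no gain. With radius at most \<open>s / 4\<close>, twice its volume
        is at most half of that of the ball of radius \<open>s\<close>.\<close>
      define \<epsilon> where "\<epsilon> = min e0 (s / 4)"
      have \<epsilon>: "0 < \<epsilon>" "\<epsilon> \<le> s / 4" "cball xs \<epsilon> \<subseteq> ball 0 1 \<inter> \<Omega>"
        using e0 s by (auto simp: \<epsilon>_def)
      define q where "q z = u z * weight z" for z
      have q0: "q z \<ge> 0" for z by (simp add: q_def u0 weight_nonneg)
      have q_int: "integrable lebesgue q" "integral\<^sup>L lebesgue q = 1"
        unfolding q_def[abs_def] using normalised_weight[OF norm_u] by auto
      define R where "R y = indicator (ball 0 s) y * ((norm y)\<^sup>2 * norm y powr - p)" for y :: 'a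
      \<comment> \<open>The last term also pays for the points \<open>y\<close> in \<open>ball 0 s\<close> with \<open>u (xs + y) > L / 2\<close>
        or \<open>u (xs - y) > L / 2\<close> (Markov's inequality).\<close>
      define H where "H y = 2 * Lam * P * C1 * R y
          - lam * L * (2 - \<alpha>) * s powr - p * (indicator (ball 0 s) y - 2 * indicator (ball 0 \<epsilon>) y)
          + B * s powr - p * (q (xs + y) + q (xs - y))" for y
      have R_int: "integrable lebesgue R" "integral\<^sup>L lebesgue R \<le> C5 * s powr (2 - \<alpha>)"
        unfolding R_def[abs_def] using C5(2,3)[OF s(1)] by auto
      note q_tr = lebesgue_integral_translate[OF q_int(1), of xs]
      have H_int: "integrable lebesgue H"
        unfolding H_def[abs_def] using R_int q_tr by simp
      have H_val: "integral\<^sup>L lebesgue H = 2 * Lam * P * C1 * integral\<^sup>L lebesgue R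
          - lam * L * (2 - \<alpha>) * s powr - p * (V * s ^ d - 2 * (V * \<epsilon> ^ d)) + B * s powr - p * 2"
        unfolding H_def[abs_def] using R_int q_tr q_int s \<epsilon>
          integral_indicator_ball[of s "0::'a"] integral_indicator_ball[of \<epsilon> "0::'a"]
        by (simp add: V_def d_def)
      have "integral\<^sup>L lebesgue H \<le> - (c2 / 2)"
      proof -
        have sp: "s powr - p * s ^ d = s powr - \<alpha>"
          using s by (simp add: p_def powr_add[symmetric] flip: powr_realpow)
        have t1: "2 * Lam * P * C1 * integral\<^sup>L lebesgue R \<le> L * s powr - \<alpha> * (c2 / 4)"
        proof -
          have "2 * Lam * P * C1 * integral\<^sup>L lebesgue R \<le> 2 * Lam * P * C1 * (C5 * s powr (2 - \<alpha>))"
            using R_int Lam_pos P C1 by (intro mult_left_mono) auto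
          also have "s powr (2 - \<alpha>) = s\<^sup>2 * s powr - \<alpha>"
            using s by (simp add: powr_diff powr_minus_divide flip: powr_numeral)
          also have "2 * Lam * P * C1 * (C5 * (s\<^sup>2 * s powr - \<alpha>)) = L * s powr - \<alpha> * (c2 / 4)"
            using s Lam_pos C1 C5 by (simp add: P_def A_def power2_eq_square field_simps)
          finally show ?thesis .
        qed
        have t2: "L * s powr - \<alpha> * c2 \<le> lam * L * (2 - \<alpha>) * s powr - p * (V * s ^ d - 2 * (V * \<epsilon> ^ d))"
        proof -
          have "\<epsilon> ^ d \<le> (s / 4) ^ d" using \<epsilon> by (intro power_mono) auto
          also have "\<dots> = s ^ d * (1/4) ^ d" by (simp add: power_divide)
          also have "\<dots> \<le> s ^ d * (1/4) ^ 1"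
            using s d by (intro mult_left_mono power_decreasing) auto
          finally have "V * (s ^ d / 2) \<le> V * (s ^ d - 2 * \<epsilon> ^ d)" using V by (intro mult_left_mono) auto
          then have "lam * L * (2 - \<alpha>) * s powr - p * (V * (s ^ d / 2))
             \<le> lam * L * (2 - \<alpha>) * s powr - p * (V * s ^ d - 2 * (V * \<epsilon> ^ d))"
            using lam L1 exponents by (intro mult_left_mono, simp add: algebra_simps, simp)
          moreover have "lam * L * (2 - \<alpha>) * s powr - p * (V * (s ^ d / 2)) = L * (s powr - p * s ^ d) * c2"
            by (simp add: c2_def)
          ultimately show ?thesis unfolding sp by linarith
        qed
        have t3: "B * s powr - p * 2 \<le> L * s powr - \<alpha> * (c2 / 4)"
        proof -
          have "2 * B * (2 / \<theta>) ^ d * 4 / c2 \<le> L * d1 ^ d" using T0 LT by linarith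
          moreover have "X \<le> Y * (c2 / 4)" if "X * 4 / c2 \<le> Y" for X Y
            using that c2 by (simp add: field_simps)
          ultimately have "2 * B * (2 / \<theta>) ^ d \<le> L * d1 ^ d * (c2 / 4)" by blast
          then have "2 * B * (2 / \<theta>) ^ d * (\<theta> / 2) ^ d \<le> L * d1 ^ d * (c2 / 4) * (\<theta> / 2) ^ d"
            using \<theta> by (intro mult_right_mono) auto
          moreover have "(2 / \<theta>) ^ d * (\<theta> / 2) ^ d = 1"
            using \<theta> by (simp flip: power_mult_distrib)
          moreover have "d1 ^ d * (\<theta> / 2) ^ d = s ^ d"
            by (simp add: s_def mult.commute flip: power_mult_distrib)
          ultimately have "2 * B \<le> L * s ^ d * (c2 / 4)" by (simp add: mult_ac)
          then have "s powr - p * (2 * B) \<le> s powr - p * (L * s ^ d * (c2 / 4))"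
            by (intro mult_left_mono) auto
          also have "\<dots> = L * (s powr - p * s ^ d) * (c2 / 4)" by simp
          finally show ?thesis unfolding sp by (simp add: mult_ac)
        qed
        \<comment> \<open>Turns the surplus \<open>c2 / 2\<close>, measured in units of
          \<open>L * s powr - \<alpha>\<close>, into a bound independent of \<open>u\<close>, so
          that \<open>\<delta>\<close> can be chosen in advance.\<close>
        have "1 \<le> s powr - \<alpha>" using powr_mono2'[of "- \<alpha>" s 1] s \<alpha>_pos by simp
        then have "1 * 1 \<le> L * s powr - \<alpha>" using L1 by (intro mult_mono) auto
        then have "1 * (c2 / 2) \<le> L * s powr - \<alpha> * (c2 / 2)" using c2 by (intro mult_right_mono) auto
        then show ?thesis unfolding H_val using t1 t2 t3 by simp
      qed
      moreover have "g xs \<le> integral\<^sup>L lebesgue H"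
      proof (rule subsolution_test[OF visc \<epsilon>(1,3) _ _ H_int])
        show touch: "u z \<le> G xs + P * (norm (z - x1))\<^sup>2" if "z \<in> ball xs \<epsilon>" for z
        proof -
          have "norm (z - x1) \<le> norm (z - xs) + norm (xs - x1)"
            by (metis add_diff_cancel_left' add_diff_eq diff_add_cancel norm_triangle_ineq)
          also have "\<dots> \<le> 2 * s" using that xs_s \<epsilon> s by (simp add: dist_norm norm_minus_commute)
          finally show ?thesis using xs_max[of z] by (simp add: G_def)
        qed
        show "u xs = G xs + P * (norm (xs - x1))\<^sup>2" by (simp add: G_def)
        fix y :: 'a
        assume y: "y \<noteq> 0"
        define v where "v = (\<lambda>z. if z \<in> ball xs \<epsilon> then G xs + P * (norm (z - x1))\<^sup>2 else u z)"
        have vxs: "v xs = u xs" using \<epsilon> by (simp add: v_def G_def)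
        have k0: "kern y \<ge> 0" by (rule kern_nonneg)
        have Bs: "B * s powr - p * (q (xs + y) + q (xs - y)) \<ge> 0"
          using B q0 by simp
        have "pucci_fun (second_diff v xs y) * kern y \<le> H y"
        proof (cases "norm y < s")
          case True
          have kmin: "(2 - \<alpha>) * s powr - p \<le> kern y"
          proof -
            have "s powr - p \<le> norm y powr - p" using True y p by (intro powr_mono2') auto
            then have "(2 - \<alpha>) * s powr - p \<le> (2 - \<alpha>) * norm y powr - p"
              using exponents by (intro mult_left_mono) auto
            also have "\<dots> \<le> kern y" unfolding p_def d_def by (rule kern_ge[OF y])
            finally show ?thesis .
          qed
          have v_le: "v (xs + z) \<le> G xs + P * (norm (xs + z - x1))\<^sup>2" if "norm z < s" for z
          proof -
            have "norm (xs + z - x1) \<le> norm (xs - x1) + norm z"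
              using norm_triangle_ineq[of "xs - x1" z] by (simp add: algebra_simps)
            then have "norm (xs + z - x1) \<le> 2 * s" using that xs_s by simp
            then show ?thesis using xs_max[of "xs + z"] by (auto simp: v_def G_def)
          qed
          have D_le: "second_diff v xs y \<le> 2 * P * (norm y)\<^sup>2"
          proof -
            have "second_diff v xs y \<le> second_diff (\<lambda>z. G xs + P * (norm (z - x1))\<^sup>2) xs y"
              using v_le[of y] v_le[of "- y"] True vxs by (simp add: second_diff_def G_def)
            then show ?thesis by (simp only: second_diff_paraboloid)
          qed
          have Ry: "R y = (norm y)\<^sup>2 * norm y powr - p" using True by (simp add: R_def)
          have R0: "2 * Lam * P * C1 * R y \<ge> 0" using Ry Lam_pos P C1 by simp
          show ?thesis
          proof (cases "v (xs + y) \<le> L / 2 \<and> v (xs - y) \<le> L / 2")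
            case good: True
            \<comment> \<open>Two values of at most \<open>L / 2\<close> against twice a value of at
              least \<open>L\<close>.\<close>
            have "second_diff v xs y \<le> 0 - L" using good uxs vxs by (simp add: second_diff_def)
            then have "pucci_fun (second_diff v xs y) \<le> Lam * 0 - lam * L"
              using lam L1 by (intro pucci_le) auto
            then have "pucci_fun (second_diff v xs y) * kern y \<le> (- (lam * L)) * kern y"
              using k0 by (intro mult_right_mono) auto
            also have "\<dots> \<le> - (lam * L * ((2 - \<alpha>) * s powr - p))"
              using mult_left_mono[OF kmin, of "lam * L"] lam L1 by simp
            also have "\<dots> \<le> - (lam * L * ((2 - \<alpha>) * s powr - p)) * (indicator (ball 0 s) y - 2 * indicator (ball 0 \<epsilon>) y)"
              using True lam L1 exponents by (auto simp: indicator_def)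
            finally show ?thesis unfolding H_def using R0 Bs by (simp add: mult_ac)
          next
            case bad: False
            have "pucci_fun (second_diff v xs y) \<le> Lam * (2 * P * (norm y)\<^sup>2) - lam * 0"
              using lam D_le P by (intro pucci_le) auto
            then have "pucci_fun (second_diff v xs y) * kern y \<le> (Lam * (2 * P * (norm y)\<^sup>2)) * kern y"
              using k0 by (intro mult_right_mono) auto
            also have "\<dots> \<le> (Lam * (2 * P * (norm y)\<^sup>2)) * (C1 * norm y powr - p)"
              using C1(2)[OF y] True s Lam_pos P by (intro mult_left_mono) auto
            also have "\<dots> = 2 * Lam * P * C1 * R y" by (simp add: Ry)
            finally have 1: "pucci_fun (second_diff v xs y) * kern y \<le> 2 * Lam * P * C1 * R y" .
            have "lam * L * (2 - \<alpha>) * s powr - p * (indicator (ball 0 s) y - 2 * indicator (ball 0 \<epsilon>) y)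
                \<le> B * s powr - p * (q (xs + y) + q (xs - y))"
            proof (cases "norm y < \<epsilon>")
              case True
              have "lam * L * (2 - \<alpha>) * s powr - p * (indicator (ball 0 s) y - 2 * indicator (ball 0 \<epsilon>) y) \<le> 0"
                using True \<open>norm y < s\<close> lam L1 exponents by simp
              then show ?thesis using Bs by linarith
            next
              case False
              \<comment> \<open>Pointwise Markov inequality: the weight is at least 1/2 in the unit
                ball, so a value above \<open>L / 2\<close> forces \<open>q\<close> above
                \<open>L / 4\<close>.\<close>
              have q_ge: "L / 4 \<le> q (xs + z)" if "norm z < s" "L / 2 < u (xs + z)" for z
              proof -
                have "norm (xs + z) \<le> 1"
                  using in_ball(1)[of "xs + z"] norm_triangle_ineq[of "xs - x1" z] xs_s that
                  by (simp add: algebra_simps)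
                then have "(L / 2) * (1 / 2) \<le> u (xs + z) * weight (xs + z)"
                  using that L1 by (intro mult_mono weight_ge_half u0) auto
                then show ?thesis by (simp add: q_def)
              qed
              have "v (xs + y) = u (xs + y)" "v (xs - y) = u (xs - y)"
                using False by (auto simp: v_def dist_norm)
              then have "L / 4 \<le> q (xs + y) + q (xs - y)"
                using bad q_ge[of y] q_ge[of "- y"] \<open>norm y < s\<close> q0[of "xs + y"] q0[of "xs - y"]
                by (simp add: not_le) linarith
              then have le1: "B * s powr - p * (L / 4) \<le> B * s powr - p * (q (xs + y) + q (xs - y))"
                using B by (intro mult_left_mono) auto
              have ind: "(indicator (ball 0 s) y :: real) - 2 * indicator (ball 0 \<epsilon>) y = 1"
                using False \<open>norm y < s\<close> by simp
              have "lam * L * (2 - \<alpha>) * s powr - p * 1 = (4 * lam * (2 - \<alpha>)) * (s powr - p * (L / 4))"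
                by simp
              also have "\<dots> \<le> B * (s powr - p * (L / 4))"
                using L1 Lam_pos C3 by (intro mult_right_mono) (auto simp: B_def)
              also have "\<dots> = B * s powr - p * (L / 4)" by simp
              finally show ?thesis unfolding ind using le1 by linarith
            qed
            with 1 show ?thesis unfolding H_def by linarith
          qed
        next
          case False
          have out: "v (xs + y) = u (xs + y)" "v (xs - y) = u (xs - y)"
            using False \<epsilon> s by (auto simp: v_def dist_norm)
          have "second_diff v xs y \<le> (u (xs + y) + u (xs - y)) - 0"
            using u0[of xs] by (simp add: second_diff_def out vxs)
          then have "pucci_fun (second_diff v xs y) \<le> Lam * (u (xs + y) + u (xs - y)) - lam * 0"
            using lam u0 by (intro pucci_le) auto
          then have "pucci_fun (second_diff v xs y) * kern y \<le> Lam * (u (xs + y) * kern y + u (xs - y) * kern y)"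
            using mult_right_mono[OF _ k0] by (fastforce simp: algebra_simps)
          also have "\<dots> \<le> Lam * (u (xs + y) * (C3 * s powr - p * weight (xs + y)) + u (xs - y) * (C3 * s powr - p * weight (xs - y)))"
            using C3(2)[of s y xs] C3(2)[of s "- y" xs] s False xs1 u0 Lam_pos
            by (intro mult_left_mono add_mono) auto
          also have "\<dots> = (Lam * C3) * (s powr - p * (q (xs + y) + q (xs - y)))"
            by (simp add: q_def algebra_simps)
          also have "\<dots> \<le> B * (s powr - p * (q (xs + y) + q (xs - y)))"
            using q0 lam exponents by (intro mult_right_mono) (auto simp: B_def)
          also have "\<dots> = H y"
            using False \<epsilon> s by (simp add: H_def R_def)
          finally show ?thesis .
        qed
        then show "pucci_fun (second_diff (\<lambda>z. if z \<in> ball xs \<epsilon> then G xs + P * (norm (z - x1))\<^sup>2 else u z) xs y) * kern y \<le> H y"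
          by (simp add: v_def)
      qed
      ultimately show False using g[of xs] c2 by linarith
    qed
    show "\<forall>x\<in>cball 0 (7/8). u x \<le> T0 * 16 ^ d"
    proof
      fix x :: 'a
      assume "x \<in> cball 0 (7/8)"
      then have x: "norm x \<le> 7/8" by simp
      have "u x * (1/16) ^ d \<le> u x * D x ^ d"
        using x u0 by (intro mult_left_mono power_mono) (auto simp: D_def)
      also have "\<dots> \<le> T0" using x1_max[of x] x T by simp
      finally show "u x \<le> T0 * 16 ^ d" by (simp add: power_divide field_simps)
    qed
  qed
qed

text \<open>The hypothesis on \<open>-u\<close> says that \<open>u\<close> is a supersolution. All
  costs of the test are proportional to the height \<open>c\<close>, whereas at least half of the
  unit mass of \<open>u\<close> survives and enters through \<open>kern_ge_weight\<close> with a
  factor independent of \<open>c\<close>.\<close>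

lemma local_lower_bound:
  fixes \<rho> :: real
  assumes \<rho>: "0 < \<rho>"
  obtains \<delta> c where "0 < \<delta>" "0 < c"
    "\<And>\<Omega> x0 (u :: 'a::euclidean_space \<Rightarrow> real) g. ball x0 (2 * \<rho>) \<subseteq> \<Omega> \<inter> ball 0 (1/2) \<Longrightarrow>
      continuous_on (ball 0 1) u \<Longrightarrow> (\<And>x. 0 \<le> u x) \<Longrightarrow> normalised \<alpha> \<phi> u \<Longrightarrow>
      viscosity_subsolution (Mplus lam Lam \<alpha> \<phi>) (\<lambda>x. - u x) g (ball 0 1 \<inter> \<Omega>) \<Longrightarrow> (\<And>x. - \<delta> \<le> g x) \<Longrightarrow>
      \<forall>x\<in>cball x0 \<rho>. c \<le> u x"
proof -
  define p where "p = real DIM('a) + \<alpha>"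
  define V where "V = unit_ball_vol DIM('a)"
  have p: "p > 0" using \<alpha>_pos by (simp add: p_def)
  have V: "V > 0" by (simp add: V_def)
  obtain C1 where C1: "0 < C1" "\<And>y::'a. y \<noteq> 0 \<Longrightarrow> norm y \<le> 2 \<Longrightarrow> kern y \<le> C1 * norm y powr - p"
    unfolding p_def using kern_le by blast
  obtain c0 where c0: "0 < c0" "\<And>x (y::'a). y \<noteq> 0 \<Longrightarrow> norm x \<le> 1 \<Longrightarrow> c0 * weight (x + y) \<le> kern y"
    using kern_ge_weight by blast
  define R where "R y = indicator (ball 0 1) y * ((norm y)\<^sup>2 * norm y powr - p)" for y :: 'a
  define F where "F y = indicator (- ball 0 1) y * kern y" for y :: 'a
  have R_int: "integrable lebesgue R"
  proof (rule integrable_radial_power[of p, where 'a='a])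
    fix C assume "\<And>r. 0 < r \<Longrightarrow> integrable lebesgue (\<lambda>y::'a. indicator (ball 0 r) y * ((norm y)\<^sup>2 * norm y powr - p))"
    from this[of 1] show ?thesis by (simp add: R_def[abs_def])
  qed (use p exponents in \<open>simp_all add: p_def\<close>)
  have F_int: "integrable lebesgue F" unfolding F_def[abs_def] by (rule kern_integrable_far)
  \<comment> \<open>Cost per unit of \<open>c\<close>: the paraboloid, the second difference of at
    most \<open>4 * c\<close> far away, and the loss from counting only the excess of
    \<open>u\<close> over \<open>2 * c\<close> in the unit ball, where the weight is at most
    2.\<close>
  define G where "G = 2 * Lam * C1 / \<rho>\<^sup>2 * integral\<^sup>L lebesgue R + 4 * Lam * integral\<^sup>L lebesgue F + 4 * lam * c0 * V"
  have G: "G > 0"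
  proof -
    have "0 \<le> integral\<^sup>L lebesgue R" "0 \<le> integral\<^sup>L lebesgue F"
      by (auto intro!: Bochner_Integration.integral_nonneg simp: R_def F_def kern_nonneg)
    then show ?thesis unfolding G_def using lam Lam_pos C1 \<rho> c0 V
      by (intro add_nonneg_pos add_nonneg_nonneg mult_nonneg_nonneg) auto
  qed
  \<comment> \<open>The entry 1 keeps \<open>u\<close> below 3 near the contact point; the other
    limits the total cost to a quarter of the gain \<open>lam * c0 / 2\<close>.\<close>
  define c where "c = min 1 (lam * c0 / 8 / G)"
  have c: "0 < c" "c \<le> 1" "c * G \<le> lam * c0 / 8"
  proof -
    show "0 < c" "c \<le> 1" unfolding c_def using lam c0 G by simp_all
    have "c \<le> lam * c0 / 8 / G" unfolding c_def by simp
    then show "c * G \<le> lam * c0 / 8" using G by (simp add: pos_le_divide_eq)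
  qed
  show ?thesis
  proof (rule that[of "lam * c0 / 8" c])
    show "0 < lam * c0 / 8" "0 < c" using lam c0 c by auto
    fix \<Omega> and x0 :: 'a and u :: "'a \<Rightarrow> real" and g
    assume sub: "ball x0 (2 * \<rho>) \<subseteq> \<Omega> \<inter> ball 0 (1/2)" and cont: "continuous_on (ball 0 1) u"
      and u0: "\<And>x. 0 \<le> u x" and norm_u: "normalised \<alpha> \<phi> u"
      and visc: "viscosity_subsolution (Mplus lam Lam \<alpha> \<phi>) (\<lambda>x. - u x) g (ball 0 1 \<inter> \<Omega>)"
      and g: "\<And>x. - (lam * c0 / 8) \<le> g x"
    show "\<forall>x\<in>cball x0 \<rho>. c \<le> u x"
    proof (rule ccontr)
      assume "\<not> (\<forall>x\<in>cball x0 \<rho>. c \<le> u x)"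
      then obtain x1 where x1: "norm (x1 - x0) \<le> \<rho>" "u x1 < c"
        by (auto simp: dist_norm norm_minus_commute not_le)
      define s where "s = c / \<rho>\<^sup>2"
      have s: "s > 0" "s * \<rho>\<^sup>2 = c" unfolding s_def using c \<rho> by simp_all
      \<comment> \<open>The paraboloid rises by \<open>9 / 4 * c\<close> at radius
        \<open>3 / 2 * \<rho>\<close>, more than the minimal value \<open>Q xs < 2 * c\<close>. It
        is therefore positive outside \<open>K\<close>, so it lies above \<open>-u\<close> in the
        whole space.\<close>
      define K where "K = cball x0 (3 / 2 * \<rho>)"
      have K: "K \<subseteq> ball x0 (2 * \<rho>)" unfolding K_def using \<rho> by auto
      define Q where "Q x = u x + s * (norm (x - x0))\<^sup>2" for x
      have "\<exists>x\<in>K. \<forall>y\<in>K. Q x \<le> Q y"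
      proof (intro continuous_attains_inf)
        have "K \<subseteq> ball 0 1" using K sub subset_ball[of "1/2" 1 "0::'a"] by auto
        then show "continuous_on K Q"
          unfolding Q_def by (intro continuous_intros continuous_on_subset[OF cont])
      qed (use \<rho> in \<open>auto simp: K_def\<close>)
      then obtain xs where xs: "xs \<in> K" and xs_min: "\<And>y. y \<in> K \<Longrightarrow> Q xs \<le> Q y" by blast
      have "x1 \<in> K" using x1 \<rho> by (auto simp: K_def dist_norm norm_minus_commute)
      have Qxs: "Q xs < 2 * c"
      proof -
        have "s * (norm (x1 - x0))\<^sup>2 \<le> s * \<rho>\<^sup>2" using x1 s by (intro mult_left_mono power_mono) auto
        then show ?thesis using xs_min[OF \<open>x1 \<in> K\<close>] x1 s by (simp add: Q_def)
      qed
      have uxs: "u xs \<le> 2 * c" using Qxs s by (simp add: Q_def) (smt (verit) mult_nonneg_nonneg zero_le_power2)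
      define \<Psi> where "\<Psi> z = - Q xs + s * (norm (z - x0))\<^sup>2" for z
      have \<Psi>_ge: "- 2 * c \<le> \<Psi> z" for z using Qxs s by (simp add: \<Psi>_def) (smt (verit) mult_nonneg_nonneg zero_le_power2)
      have \<Psi>_above: "- u z \<le> \<Psi> z" for z
      proof (cases "z \<in> K")
        case True
        then show ?thesis using xs_min[of z] by (simp add: Q_def \<Psi>_def)
      next
        case False
        then have "3 / 2 * \<rho> \<le> norm (z - x0)" by (auto simp: K_def dist_norm norm_minus_commute)
        then have "s * (3 / 2 * \<rho>)\<^sup>2 \<le> s * (norm (z - x0))\<^sup>2" using s \<rho> by (intro mult_left_mono power_mono) auto
        moreover have "s * (3 / 2 * \<rho>)\<^sup>2 = 9 / 4 * c" using s by (simp add: power_mult_distrib power2_eq_square)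
        ultimately show ?thesis using Qxs u0[of z] c by (simp add: \<Psi>_def)
      qed
      have "xs \<in> ball x0 (2 * \<rho>)" using xs K by auto
      then obtain e0 where e0: "e0 > 0" "cball xs e0 \<subseteq> ball x0 (2 * \<rho>)"
        using open_contains_cball[of "ball x0 (2 * \<rho>)"] by (meson open_ball)
      have xs_half: "norm xs < 1/2" using \<open>xs \<in> ball x0 (2 * \<rho>)\<close> sub by auto
      have "continuous (at xs) u" 
        using cont xs_half by (simp add: continuous_on_eq_continuous_at)
      then obtain e1 where e1: "e1 > 0" "\<And>z. dist z xs < e1 \<Longrightarrow> dist (u z) (u xs) < 1"
        unfolding continuous_at_eps_delta by (metis zero_less_one)
      \<comment> \<open>\<open>e1\<close> gives \<open>u \<le> 3\<close> on the ball; with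
        \<open>1 / (12 * V)\<close> its weighted mass is at most 1/2. Exactly this mass, the
        integral of \<open>qN\<close>, is lost when the paraboloid replaces
        \<open>-u\<close>.\<close>
      define \<epsilon> where "\<epsilon> = min (min e0 e1) (min (1/2) (1 / (12 * V)))"
      have \<epsilon>: "0 < \<epsilon>" "\<epsilon> \<le> e0" "\<epsilon> \<le> e1" "\<epsilon> \<le> 1/2" "\<epsilon> \<le> 1 / (12 * V)"
      proof -
        have "0 < 1 / (12 * V)" using V by simp
        then show "0 < \<epsilon>" "\<epsilon> \<le> e0" "\<epsilon> \<le> e1" "\<epsilon> \<le> 1/2" "\<epsilon> \<le> 1 / (12 * V)"
          using e0(1) e1(1) unfolding \<epsilon>_def by linarith+
      qed
      have \<epsilon>_sub: "cball xs \<epsilon> \<subseteq> ball 0 1 \<inter> \<Omega>"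
      proof -
        have "cball xs \<epsilon> \<subseteq> cball xs e0" using \<epsilon> by auto
        also have "\<dots> \<subseteq> \<Omega> \<inter> ball 0 (1/2)" using e0 sub by auto
        also have "\<dots> \<subseteq> ball 0 1 \<inter> \<Omega>" by auto
        finally show ?thesis .
      qed
      define q where "q z = u z * weight z" for z
      define qN where "qN z = indicator (ball xs \<epsilon>) z * q z" for z
      have q0: "q z \<ge> 0" for z by (simp add: q_def u0 weight_nonneg)
      have q_int: "integrable lebesgue q" "integral\<^sup>L lebesgue q = 1"
        unfolding q_def[abs_def] using normalised_weight[OF norm_u] by auto
      have qN_int: "integrable lebesgue qN"
        unfolding qN_def using integrable_real_mult_indicator[OF _ q_int(1), of "ball xs \<epsilon>"] by (simp add: mult.commute)
      have qN_small: "integral\<^sup>L lebesgue qN \<le> 1 / 2"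
      proof -
        have "integral\<^sup>L lebesgue qN \<le> (LINT z|lebesgue. 6 * indicator (ball xs \<epsilon>) z)"
        proof (rule integral_mono[OF qN_int])
          fix z
          show "qN z \<le> 6 * indicator (ball xs \<epsilon>) z"
          proof (cases "z \<in> ball xs \<epsilon>")
            case True
            then have "dist (u z) (u xs) < 1" using \<epsilon> by (intro e1) (auto simp: dist_commute)
            then have "u z \<le> 3" using uxs c by (auto simp: dist_real_def)
            then have "q z \<le> 3 * 2" unfolding q_def by (intro mult_mono weight_le_2 u0 weight_nonneg) auto
            then show ?thesis using True by (simp add: qN_def)
          qed (simp add: qN_def)
        qed simp
        also have "\<dots> = 6 * (V * \<epsilon> ^ DIM('a))" using \<epsilon> integral_indicator_ball[of \<epsilon> xs] by (simp add: V_def)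
        also have "\<dots> \<le> 6 * (V * \<epsilon> ^ 1)"
          using \<epsilon> V by (intro mult_left_mono power_decreasing) auto
        also have "\<dots> \<le> 1 / 2" using \<epsilon>(5) V by (simp add: field_simps)
        finally show ?thesis .
      qed
      define H where "H y = c * (2 * Lam * C1 / \<rho>\<^sup>2 * R y + 4 * Lam * F y + 4 * lam * c0 * indicator (ball 0 1) y)
        - lam * c0 * (q (xs + y) - qN (xs + y))" for y
      note tr = lebesgue_integral_translate[OF q_int(1), of xs] lebesgue_integral_translate[OF qN_int, of xs]
      have H_int: "integrable lebesgue H"
        unfolding H_def[abs_def] using R_int F_int tr by simp
      have "integral\<^sup>L lebesgue H = c * G - lam * c0 * (1 - integral\<^sup>L lebesgue qN)"
        unfolding H_def[abs_def] G_def using R_int F_int tr q_int integral_indicator_ball[of 1 "0::'a"]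
        by (simp add: V_def)
      also have "\<dots> \<le> lam * c0 / 8 - lam * c0 * (1 / 2)"
        using c qN_small lam c0 by (intro diff_mono mult_left_mono) auto
      finally have "integral\<^sup>L lebesgue H \<le> - (3 / 8 * (lam * c0))" by linarith
      moreover have "g xs \<le> integral\<^sup>L lebesgue H"
      proof (rule subsolution_test[OF visc \<epsilon>(1) \<epsilon>_sub _ _ H_int])
        show "- u z \<le> - Q xs + s * (norm (z - x0))\<^sup>2" for z using \<Psi>_above[of z] by (simp add: \<Psi>_def)
        show "- u xs = - Q xs + s * (norm (xs - x0))\<^sup>2" by (simp add: Q_def)
        fix y :: 'a
        assume y: "y \<noteq> 0"
        define v where "v = (\<lambda>z. if z \<in> ball xs \<epsilon> then \<Psi> z else - u z)"
        define r where "r z = (if z \<in> ball xs \<epsilon> then 0 else u z)" for z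
        have r0: "r z \<ge> 0" for z using u0 by (simp add: r_def)
        have rq: "r z * weight z = q z - qN z" for z by (simp add: r_def q_def qN_def)
        have \<Psi>xs: "\<Psi> xs = - u xs" by (simp add: \<Psi>_def Q_def)
        have vxs: "v xs = - u xs" using \<epsilon> by (simp add: v_def \<Psi>xs)
        have v_le: "v z \<le> \<Psi> z" for z using \<Psi>_above[of z] by (simp add: v_def)
        have k0: "kern y \<ge> 0" by (rule kern_nonneg)
        have kw: "c0 * weight (xs + y) \<le> kern y" using c0(2)[OF y, of xs] xs_half by simp
        have "pucci_fun (second_diff v xs y) * kern y \<le> H y"
        proof (cases "norm y < 1")
          case True
          \<comment> \<open>Lower bound for the gap between paraboloid and test function at
            \<open>xs + y\<close>: outside the small ball it is at least
            \<open>u (xs + y) - 2 * c\<close>. The gap at \<open>xs - y\<close> is dropped, as one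
            translate of the mass suffices.\<close>
          define W where "W = max 0 (r (xs + y) - 2 * c)"
          have "W \<le> \<Psi> (xs + y) - v (xs + y)"
            using v_le[of "xs + y"] \<Psi>_ge[of "xs + y"] c by (auto simp: W_def r_def v_def)
          then have "second_diff v xs y \<le> second_diff \<Psi> xs y - W"
            using v_le[of "xs - y"] by (simp add: second_diff_def vxs \<Psi>xs)
          also have "second_diff \<Psi> xs y = 2 * s * (norm y)\<^sup>2"
            unfolding \<Psi>_def[abs_def] by (rule second_diff_paraboloid)
          finally have "pucci_fun (second_diff v xs y) \<le> Lam * (2 * s * (norm y)\<^sup>2) - lam * W"
            using lam s by (intro pucci_le) (auto simp: W_def)
          then have "pucci_fun (second_diff v xs y) * kern y \<le> (Lam * (2 * s * (norm y)\<^sup>2) - lam * W) * kern y"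
            using k0 by (rule mult_right_mono)
          also have "\<dots> = (Lam * (2 * s * (norm y)\<^sup>2)) * kern y - lam * W * kern y" by (simp add: algebra_simps)
          also have "\<dots> \<le> (Lam * (2 * s * (norm y)\<^sup>2)) * (C1 * norm y powr - p) - lam * W * (c0 * weight (xs + y))"
            using C1(2)[OF y] True s Lam_pos lam kw by (intro diff_mono mult_left_mono) (auto simp: W_def)
          also have "\<dots> \<le> (Lam * (2 * s * (norm y)\<^sup>2)) * (C1 * norm y powr - p) - lam * c0 * (q (xs + y) - qN (xs + y) - 4 * c)"
          proof -
            have "q (xs + y) - qN (xs + y) - 4 * c \<le> (r (xs + y) - 2 * c) * weight (xs + y)"
              using weight_le_2[of "xs + y"] c mult_left_mono[of "weight (xs + y)" 2 "2 * c"]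
              by (simp add: left_diff_distrib rq)
            also have "\<dots> \<le> W * weight (xs + y)"
              by (intro mult_right_mono weight_nonneg) (auto simp: W_def)
            finally have "lam * c0 * (q (xs + y) - qN (xs + y) - 4 * c) \<le> lam * c0 * (W * weight (xs + y))"
              using lam c0 by (intro mult_left_mono) auto
            then show ?thesis by (simp add: mult_ac)
          qed
          also have "\<dots> = H y" using True by (simp add: H_def R_def F_def s_def algebra_simps)
          finally show ?thesis .
        next
          case False
          have out: "v (xs + y) = - r (xs + y)" "v (xs - y) = - u (xs - y)"
            using False \<epsilon> by (auto simp: v_def r_def dist_norm)
          have "second_diff v xs y \<le> 4 * c - r (xs + y)"
            using u0[of "xs - y"] uxs by (simp add: second_diff_def out vxs)
          then have "pucci_fun (second_diff v xs y) \<le> Lam * (4 * c) - lam * r (xs + y)"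
            using lam c r0 by (intro pucci_le) auto
          then have "pucci_fun (second_diff v xs y) * kern y \<le> (Lam * (4 * c) - lam * r (xs + y)) * kern y"
            using k0 by (rule mult_right_mono)
          also have "\<dots> = Lam * (4 * c) * kern y - lam * r (xs + y) * kern y" by (simp add: algebra_simps)
          also have "\<dots> \<le> Lam * (4 * c) * kern y - lam * r (xs + y) * (c0 * weight (xs + y))"
            using lam kw r0 by (intro diff_mono[OF order_refl] mult_left_mono) auto
          also have "\<dots> = Lam * (4 * c) * kern y - lam * c0 * (r (xs + y) * weight (xs + y))" by simp
          also have "\<dots> = H y"
            using False unfolding rq by (simp add: H_def F_def R_def)
          finally show ?thesis .
        qed
        then show "pucci_fun (second_diff (\<lambda>z. if z \<in> ball xs \<epsilon> then - Q xs + s * (norm (z - x0))\<^sup>2 else - u z) xs y) * kern y \<le> H y"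
          by (simp only: v_def \<Psi>_def)
      qed
      ultimately show False using g[of xs] mult_pos_pos[OF lam(1) c0(1)] by linarith
    qed
  qed
qed

text \<open>The contact point stays within radius 3/4, the upper bound \<open>M\<close> holds up to
  7/8, and \<open>u2\<close> is bounded below on a ball within radius 1/2. The gap 1/8 keeps the
  uncontrolled values of \<open>u1\<close> away from the singularity of the kernel.\<close>

lemma quotient_upper_bound:
  fixes \<rho> M c :: real
  assumes \<rho>: "0 < \<rho>" and M: "0 < M" and c: "0 < c"
  obtains \<delta> C where "0 < \<delta>" "0 < C"
    "\<And>\<Omega> x0 (u1 :: 'a::euclidean_space \<Rightarrow> real) u2 g. open \<Omega> \<Longrightarrow> ball x0 (2 * \<rho>) \<subseteq> \<Omega> \<inter> ball 0 (1/2) \<Longrightarrow>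
      continuous_on (ball 0 1) u1 \<Longrightarrow> continuous_on (ball 0 1) u2 \<Longrightarrow>
      (\<And>x. 0 \<le> u1 x) \<Longrightarrow> (\<And>x. 0 \<le> u2 x) \<Longrightarrow> (\<And>x. x \<in> ball 0 1 - \<Omega> \<Longrightarrow> u1 x = 0) \<Longrightarrow>
      normalised \<alpha> \<phi> u1 \<Longrightarrow> \<forall>x\<in>cball 0 (7/8). u1 x \<le> M \<Longrightarrow> \<forall>x\<in>cball x0 \<rho>. c \<le> u2 x \<Longrightarrow>
      viscosity_subsolution (Mplus lam Lam \<alpha> \<phi>) (\<lambda>x. u1 x - C * u2 x) g (ball 0 1 \<inter> \<Omega>) \<Longrightarrow>
      (\<And>x. - \<delta> \<le> g x) \<Longrightarrow> \<forall>x\<in>ball 0 (1/2). u1 x \<le> C * u2 x"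
proof -
  define d where "d = DIM('a)"
  define p where "p = real d + \<alpha>"
  define V where "V = unit_ball_vol d"
  have p: "p > 0" using \<alpha>_pos by (simp add: p_def)
  have V: "V > 0" by (simp add: V_def)
  obtain C1 where C1: "0 < C1" "\<And>y::'a. y \<noteq> 0 \<Longrightarrow> norm y \<le> 2 \<Longrightarrow> kern y \<le> C1 * norm y powr - p"
    unfolding p_def d_def using kern_le by blast
  obtain C3 where C3: "0 < C3" "\<And>r x (y::'a). 0 < r \<Longrightarrow> r \<le> 1 \<Longrightarrow> r \<le> norm y \<Longrightarrow> norm x \<le> 1 \<Longrightarrow>
    kern y \<le> C3 * r powr - p * weight (x + y)"
    unfolding p_def d_def using kern_le_weight by blast
  define R where "R y = indicator (ball 0 2) y * ((norm y)\<^sup>2 * norm y powr - p)" for y :: 'a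
  have R_int: "integrable lebesgue R"
  proof (rule integrable_radial_power[of p, where 'a='a])
    fix C assume "\<And>r. 0 < r \<Longrightarrow> integrable lebesgue (\<lambda>y::'a. indicator (ball 0 r) y * ((norm y)\<^sup>2 * norm y powr - p))"
    from this[of 2] show ?thesis by (simp add: R_def[abs_def])
  qed (use p exponents in \<open>simp_all add: p_def d_def\<close>)
  \<comment> \<open>Lower bound for the kernel at distances below 2, which covers all pairs of
    points of the unit ball.\<close>
  define k where "k = (2 - \<alpha>) * 2 powr - p"
  have k: "k > 0" unfolding k_def using exponents by simp
  define E where "E = C3 * (1/8) powr - p"
  have E: "E > 0" unfolding E_def using C3 by simp
  \<comment> \<open>Makes the rise at distance 1/4, the gap between the radii 1/2 and 3/4, equal to
    \<open>M\<close>.\<close>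
  define P where "P = 16 * M"
  have P: "P > 0" using M by (simp add: P_def)
  define A0 where "A0 = 2 * Lam * P * C1 * integral\<^sup>L lebesgue R + 2 * Lam * E"
  have A0: "A0 > 0"
  proof -
    have "0 \<le> integral\<^sup>L lebesgue R"
      by (auto intro!: Bochner_Integration.integral_nonneg simp: R_def)
    then show ?thesis unfolding A0_def using Lam_pos P C1 E by (intro add_nonneg_pos mult_nonneg_nonneg) auto
  qed
  \<comment> \<open>The depth of \<open>u1 - C * u2\<close> on the core for which the majorant has
    integral \<open>A0 - (A0 + 1) = -1\<close>; \<open>C\<close> is then chosen to produce this
    depth from \<open>u1 \<le> M\<close> and \<open>u2 \<ge> c\<close>.\<close>
  define C2 where "C2 = (A0 + 1) / (lam * k * (V * \<rho> ^ d))"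
  have C2: "C2 > 0" "lam * C2 * k * (V * \<rho> ^ d) = A0 + 1"
    unfolding C2_def using A0 lam k V \<rho> by simp_all
  define C where "C = (M + C2) / c"
  have C: "C > 0" "C * c = M + C2" unfolding C_def using M C2 c by simp_all
  show ?thesis
  proof (rule that[of "1 / 2" C])
    show "0 < (1 / 2 :: real)" "0 < C" using C by auto
    fix \<Omega> and x0 :: 'a and u1 u2 :: "'a \<Rightarrow> real" and g
    assume \<Omega>: "open \<Omega>" and sub: "ball x0 (2 * \<rho>) \<subseteq> \<Omega> \<inter> ball 0 (1/2)"
      and cont: "continuous_on (ball 0 1) u1" "continuous_on (ball 0 1) u2"
      and u1: "\<And>x. 0 \<le> u1 x" and u2: "\<And>x. 0 \<le> u2 x"
      and vanish: "\<And>x. x \<in> ball 0 1 - \<Omega> \<Longrightarrow> u1 x = 0"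
      and norm_u: "normalised \<alpha> \<phi> u1"
      and upper: "\<forall>x\<in>cball 0 (7/8). u1 x \<le> M" and lower: "\<forall>x\<in>cball x0 \<rho>. c \<le> u2 x"
      and visc: "viscosity_subsolution (Mplus lam Lam \<alpha> \<phi>) (\<lambda>x. u1 x - C * u2 x) g (ball 0 1 \<inter> \<Omega>)"
      and g: "\<And>x. - (1 / 2) \<le> g x"
    define w where "w x = u1 x - C * u2 x" for x
    have w_le: "w x \<le> u1 x" for x using C u2[of x] by (simp add: w_def)
    have cb: "cball x0 \<rho> \<subseteq> ball 0 (1/2)"
    proof -
      have "cball x0 \<rho> \<subseteq> ball x0 (2 * \<rho>)" using \<rho> by auto
      then show ?thesis using sub by auto
    qed
    have core_half: "norm z < 1/2" if "z \<in> ball x0 \<rho>" for z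
      using that cb ball_subset_cball[of x0 \<rho>] by (metis (no_types) in_mono mem_ball_0)
    have w_core: "w x \<le> - C2" if "x \<in> cball x0 \<rho>" for x
    proof -
      have "x \<in> ball 0 (1/2)" using that cb by auto
      then have "u1 x \<le> M" using upper by auto
      moreover have "C * c \<le> C * u2 x" using lower that C by (intro mult_left_mono) auto
      ultimately show ?thesis using C by (simp add: w_def)
    qed
    show "\<forall>x\<in>ball 0 (1/2). u1 x \<le> C * u2 x"
    proof (rule ccontr)
      assume "\<not> (\<forall>x\<in>ball 0 (1/2). u1 x \<le> C * u2 x)"
      then obtain z0 where z0: "norm z0 < 1/2" "0 < w z0" by (auto simp: w_def not_le)
      define Q where "Q x = w x - P * (norm (x - z0))\<^sup>2" for x
      have "\<exists>x\<in>cball 0 (7/8). \<forall>y\<in>cball 0 (7/8). Q y \<le> Q x"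
        unfolding Q_def w_def
        by (intro continuous_attains_sup continuous_intros continuous_on_subset[OF cont(1)]
            continuous_on_subset[OF cont(2)]) auto
      then obtain xs where xs: "norm xs \<le> 7/8" and xs_max: "\<And>y. norm y \<le> 7/8 \<Longrightarrow> Q y \<le> Q xs"
        by auto
      have Qxs: "0 < Q xs" using xs_max[of z0] z0 by (simp add: Q_def)
      have wxs: "0 < w xs" using Qxs P by (simp add: Q_def) (smt (verit) mult_nonneg_nonneg zero_le_power2)
      have xs34: "norm xs < 3/4"
      proof (rule ccontr)
        assume "\<not> norm xs < 3/4"
        then have "1/4 \<le> norm (xs - z0)" using z0 norm_triangle_ineq2[of xs z0] by linarith
        then have "P * (1/4)\<^sup>2 \<le> P * (norm (xs - z0))\<^sup>2" using P by (intro mult_left_mono power_mono) auto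
        moreover have "P * (1/4)\<^sup>2 = M" by (simp add: P_def power2_eq_square)
        moreover have "w xs \<le> M" using w_le[of xs] upper xs by force
        ultimately show False using Qxs by (simp add: Q_def)
      qed
      have "xs \<in> \<Omega>" using vanish[of xs] xs34 wxs w_le[of xs] by (auto simp: dist_norm)
      \<comment> \<open>Allows a neighbourhood that misses the core, so replacing \<open>w\<close>
        by the paraboloid there does not spoil the negative values.\<close>
      have "xs \<notin> cball x0 \<rho>" using w_core[of xs] wxs C2 by auto
      then have "xs \<in> (ball 0 (3/4) \<inter> \<Omega>) - cball x0 \<rho>" using xs34 \<open>xs \<in> \<Omega>\<close> by simp
      moreover have "open ((ball 0 (3/4) \<inter> \<Omega>) - cball x0 \<rho>)" using \<Omega> by (intro open_Diff open_Int) auto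
      ultimately obtain \<epsilon> where \<epsilon>: "\<epsilon> > 0" "cball xs \<epsilon> \<subseteq> (ball 0 (3/4) \<inter> \<Omega>) - cball x0 \<rho>"
        by (metis open_contains_cball)
      have \<epsilon>_sub: "cball xs \<epsilon> \<subseteq> ball 0 1 \<inter> \<Omega>"
        using \<epsilon>(2) subset_ball[of "3/4" 1 "0::'a"] by auto
      have ball_sub: "norm z < 3/4" "z \<notin> cball x0 \<rho>" if "z \<in> ball xs \<epsilon>" for z
        using that \<epsilon>(2) by (auto simp: subset_iff)
      define \<Psi> where "\<Psi> z = Q xs + P * (norm (z - z0))\<^sup>2" for z
      have \<Psi>0: "\<Psi> z > 0" for z using Qxs P by (auto simp: \<Psi>_def intro!: add_pos_nonneg)
      have \<Psi>_above: "w z \<le> \<Psi> z" if "norm z \<le> 7/8" for z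
        using xs_max[OF that] by (simp add: Q_def \<Psi>_def)
      define q where "q z = u1 z * weight z" for z
      have q0: "q z \<ge> 0" for z by (simp add: q_def u1 weight_nonneg)
      have q_int: "integrable lebesgue q" "integral\<^sup>L lebesgue q = 1"
        unfolding q_def[abs_def] using normalised_weight[OF norm_u] by auto
      define bump :: "'a \<Rightarrow> real" where "bump = indicator (ball x0 \<rho>)"
      have bump_int: "integrable lebesgue bump" "integral\<^sup>L lebesgue bump = V * \<rho> ^ d"
        unfolding bump_def using integral_indicator_ball[of \<rho> x0] \<rho> by (simp_all add: V_def d_def)
      define H where "H y = 2 * Lam * P * C1 * R y + Lam * E * (q (xs + y) + q (xs - y)) - lam * C2 * k * bump (xs + y)" for y
      note tr = lebesgue_integral_translate[OF q_int(1), of xs] lebesgue_integral_translate[OF bump_int(1), of xs]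
      have H_int: "integrable lebesgue H" unfolding H_def[abs_def] using R_int tr by simp
      have "integral\<^sup>L lebesgue H = A0 - lam * C2 * k * (V * \<rho> ^ d)"
        unfolding H_def[abs_def] A0_def using R_int tr q_int bump_int by simp
      then have H_val: "integral\<^sup>L lebesgue H = -1" using C2 by simp
      have "g xs \<le> integral\<^sup>L lebesgue H"
      proof (rule subsolution_test[OF visc \<epsilon>(1) \<epsilon>_sub _ _ H_int])
        show "u1 z - C * u2 z \<le> Q xs + P * (norm (z - z0))\<^sup>2" if "z \<in> ball xs \<epsilon>" for z
          using \<Psi>_above[of z] ball_sub(1)[OF that] by (simp add: \<Psi>_def w_def)
        show "u1 xs - C * u2 xs = Q xs + P * (norm (xs - z0))\<^sup>2" by (simp add: Q_def w_def)
        fix y :: 'a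
        assume y: "y \<noteq> 0"
        define v where "v = (\<lambda>z. if z \<in> ball xs \<epsilon> then \<Psi> z else w z)"
        \<comment> \<open>Allowance for the region beyond 7/8, where the paraboloid is not known to
          lie above \<open>w\<close>.\<close>
        define e where "e z = (if norm z \<le> 7/8 then 0 else u1 z)" for z
        have e0: "e z \<ge> 0" for z using u1 by (simp add: e_def)
        have bump0: "bump z \<ge> 0" for z by (simp add: bump_def)
        have \<Psi>xs: "\<Psi> xs = w xs" by (simp add: \<Psi>_def Q_def)
        have vxs: "v xs = w xs" using \<epsilon> by (simp add: v_def \<Psi>xs)
        have k0: "kern y \<ge> 0" by (rule kern_nonneg)
        have ek: "e (xs + z) * kern y \<le> E * q (xs + z)" if "z = y \<or> z = - y" for z
        proof (cases "norm (xs + z) \<le> 7/8")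
          case True
          then show ?thesis using E q0 by (simp add: e_def)
        next
          case False
          have "1/8 \<le> norm z" using False xs34 norm_triangle_ineq[of xs z] by linarith
          then have "kern z \<le> C3 * (1/8) powr - p * weight (xs + z)" using xs34 by (intro C3(2)) auto
          moreover have "kern z = kern y" using that by auto
          ultimately have "u1 (xs + z) * kern y \<le> u1 (xs + z) * (E * weight (xs + z))"
            using u1 unfolding E_def by (intro mult_left_mono) auto
          then show ?thesis using False by (simp add: e_def q_def mult_ac)
        qed
        have "pucci_fun (second_diff v xs y) * kern y \<le> H y"
        proof (cases "norm y < 2")
          case True
          \<comment> \<open>Positivity of the paraboloid does double duty: on the core
            \<open>w \<le> - C2\<close> leaves a gap of at least \<open>C2\<close>, and beyond
            radius 7/8 \<open>w \<le> u1\<close> is absorbed by \<open>e\<close> alone.\<close>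
          have v_le: "v z \<le> \<Psi> z + e z - C2 * bump z" for z
          proof (cases "z \<in> ball xs \<epsilon>")
            case True
            then have "bump z = 0" using ball_sub(2)[OF True] by (simp add: bump_def)
            then show ?thesis using True e0 by (simp add: v_def)
          next
            case out: False
            show ?thesis
            proof (cases "norm z \<le> 7/8")
              case True
              then show ?thesis
                using out \<Psi>_above[OF True] \<Psi>0[of z] w_core[of z]
                by (auto simp: v_def e_def bump_def indicator_def)
            next
              case False
              then have "z \<notin> ball x0 \<rho>" using core_half[of z] by linarith
              then show ?thesis using out False \<Psi>0[of z] w_le[of z] by (simp add: v_def e_def bump_def)
            qed
          qed
          have "second_diff v xs y \<le> second_diff \<Psi> xs y + e (xs + y) + e (xs - y) - C2 * bump (xs + y)"
          proof -
            have "0 \<le> C2 * bump (xs - y)" using C2(1) bump0 by simp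
            then show ?thesis
              using v_le[of "xs + y"] v_le[of "xs - y"] unfolding second_diff_def vxs \<Psi>xs by linarith
          qed
          also have "second_diff \<Psi> xs y = 2 * P * (norm y)\<^sup>2"
            unfolding \<Psi>_def[abs_def] by (rule second_diff_paraboloid)
          finally have "pucci_fun (second_diff v xs y)
              \<le> Lam * (2 * P * (norm y)\<^sup>2 + e (xs + y) + e (xs - y)) - lam * (C2 * bump (xs + y))"
            using lam P e0 C2 bump0 by (intro pucci_le) auto
          then have "pucci_fun (second_diff v xs y) * kern y
              \<le> (Lam * (2 * P * (norm y)\<^sup>2 + e (xs + y) + e (xs - y)) - lam * (C2 * bump (xs + y))) * kern y"
            using k0 by (rule mult_right_mono)
          also have "\<dots> = (Lam * (2 * P * (norm y)\<^sup>2)) * kern y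
              + Lam * (e (xs + y) * kern y + e (xs - y) * kern y) - (lam * C2 * bump (xs + y)) * kern y"
            by (simp add: algebra_simps)
          also have "\<dots> \<le> (Lam * (2 * P * (norm y)\<^sup>2)) * (C1 * norm y powr - p)
              + Lam * (E * q (xs + y) + E * q (xs - y)) - (lam * C2 * bump (xs + y)) * k"
          proof (intro diff_mono add_mono mult_left_mono)
            show "kern y \<le> C1 * norm y powr - p" using C1(2)[OF y] True by simp
            show "e (xs + y) * kern y \<le> E * q (xs + y)" using ek[of y] by simp
            show "e (xs - y) * kern y \<le> E * q (xs - y)" using ek[of "- y"] by simp
            have "2 powr - p \<le> norm y powr - p" using True y p by (intro powr_mono2') auto
            then have "k \<le> (2 - \<alpha>) * norm y powr - p"
              unfolding k_def using exponents by (intro mult_left_mono) auto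
            also have "\<dots> \<le> kern y" unfolding p_def d_def by (rule kern_ge[OF y])
            finally show "k \<le> kern y" .
          qed (use Lam_pos P lam C2 bump0 in auto)
          also have "\<dots> = H y" using True by (simp add: H_def R_def algebra_simps)
          finally show ?thesis .
        next
          case False
          \<comment> \<open>Both points have left the region containing the core and the
            neighbourhood of \<open>xs\<close>, so only the tail of \<open>u1\<close>
            remains.\<close>
          have far: "norm (xs + y) > 7/8" "norm (xs - y) > 7/8"
            using False xs34 norm_triangle_ineq2[of y "- xs"] norm_triangle_ineq2[of y xs]
            by (simp_all add: norm_minus_commute add.commute)
          have "v (xs + y) = w (xs + y)" "v (xs - y) = w (xs - y)"
            using far ball_sub(1)[of "xs + y"] ball_sub(1)[of "xs - y"] by (auto simp: v_def)
          then have "second_diff v xs y \<le> (e (xs + y) + e (xs - y)) - 0"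
            using w_le[of "xs + y"] w_le[of "xs - y"] wxs far by (simp add: second_diff_def vxs e_def)
          then have "pucci_fun (second_diff v xs y) \<le> Lam * (e (xs + y) + e (xs - y)) - lam * 0"
            using lam e0 by (intro pucci_le) auto
          then have "pucci_fun (second_diff v xs y) * kern y \<le> Lam * (e (xs + y) * kern y + e (xs - y) * kern y)"
            using mult_right_mono[OF _ k0] by (fastforce simp: algebra_simps)
          also have "\<dots> \<le> Lam * (E * q (xs + y) + E * q (xs - y))"
            using ek[of y] ek[of "- y"] Lam_pos by (intro mult_left_mono add_mono) auto
          also have "\<dots> = H y"
          proof -
            have "xs + y \<notin> ball x0 \<rho>" using far core_half[of "xs + y"] by linarith
            then show ?thesis using False by (simp add: H_def R_def bump_def algebra_simps)
          qed
          finally show ?thesis .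
        qed
        then show "pucci_fun (second_diff (\<lambda>z. if z \<in> ball xs \<epsilon> then Q xs + P * (norm (z - z0))\<^sup>2 else u1 z - C * u2 z) xs y) * kern y \<le> H y"
          by (simp only: v_def \<Psi>_def w_def)
      qed
      then show False using g[of xs] H_val by linarith
    qed
  qed
qed

end

section \<open>Choice of the common constants and of the linear combinations to be tested\<close>

theorem theorem6p1:
  fixes lam Lam \<alpha> \<beta> \<kappa> \<rho> :: real
    and \<phi> :: "real \<Rightarrow> real"
  assumes "0 < lam" and "lam \<le> Lam"
    and "0 < \<beta>" and "\<beta> < 2" and "\<beta> < \<alpha>" and "\<alpha> < 2"
    and "0 < \<kappa>"
    and "\<And>t. 0 < t \<Longrightarrow> 0 < \<phi> t"
    and "\<And>K. compact K \<Longrightarrow> K \<subseteq> {0<..} \<Longrightarrow> bounded (\<phi> ` K)"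
    and "mono_on {0<..} \<phi>"
    and "\<And>s t. 1 \<le> s \<Longrightarrow> 0 < t \<Longrightarrow> \<phi> (s * t) \<le> \<kappa> * s powr \<beta> * \<phi> t"
    and "set_integrable lebesgue {0<..<1} (\<lambda>y. \<phi> y / y)"
    and "0 < \<rho>"
  shows "\<exists>\<delta>>0. \<exists>C>0.
    \<forall>(\<Omega> :: 'a::euclidean_space set) (x0 :: 'a) (u1 :: 'a \<Rightarrow> real) (u2 :: 'a \<Rightarrow> real).
      open \<Omega> \<and>
      x0 \<in> ball 0 (1/2) \<and> ball x0 (2 * \<rho>) \<subseteq> \<Omega> \<inter> ball 0 (1/2) \<and>
      continuous_on (ball 0 1) u1 \<and> continuous_on (ball 0 1) u2 \<and>
      (\<forall>a b :: real. viscosity_subsolution (Mplus lam Lam \<alpha> \<phi>) (\<lambda>x. a * u1 x + b * u2 x)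
          (\<lambda>x. - \<delta> * (\<bar>a\<bar> + \<bar>b\<bar>)) (ball 0 1 \<inter> \<Omega>)) \<and>
      (\<forall>x\<in>ball 0 1 - \<Omega>. u1 x = 0 \<and> u2 x = 0) \<and>
      (\<forall>x. 0 \<le> u1 x) \<and> (\<forall>x. 0 \<le> u2 x) \<and>
      normalised \<alpha> \<phi> u1 \<and> normalised \<alpha> \<phi> u2
      \<longrightarrow> (\<forall>x\<in>ball 0 (1/2). inverse C * u2 x \<le> u1 x \<and> u1 x \<le> C * u2 x)"
proof -
  interpret pucci_kernel lam Lam \<alpha> \<beta> \<kappa> \<phi>
    using assms by unfold_locales auto
  obtain \<delta>1 M where \<delta>1: "0 < \<delta>1" and M: "0 < M" and upper:
    "\<And>\<Omega> (u :: 'a \<Rightarrow> real) g. open \<Omega> \<Longrightarrow> continuous_on (ball 0 1) u \<Longrightarrow>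
      (\<And>x. 0 \<le> u x) \<Longrightarrow> (\<And>x. x \<in> ball 0 1 - \<Omega> \<Longrightarrow> u x = 0) \<Longrightarrow> normalised \<alpha> \<phi> u \<Longrightarrow>
      viscosity_subsolution (Mplus lam Lam \<alpha> \<phi>) u g (ball 0 1 \<inter> \<Omega>) \<Longrightarrow> (\<And>x. - \<delta>1 \<le> g x) \<Longrightarrow>
      \<forall>x\<in>cball 0 (7/8). u x \<le> M"
    using local_upper_bound[where 'a='a] by blast
  obtain \<delta>2 c where \<delta>2: "0 < \<delta>2" and c: "0 < c" and lower:
    "\<And>\<Omega> x0 (u :: 'a \<Rightarrow> real) g. ball x0 (2 * \<rho>) \<subseteq> \<Omega> \<inter> ball 0 (1/2) \<Longrightarrow>
      continuous_on (ball 0 1) u \<Longrightarrow> (\<And>x. 0 \<le> u x) \<Longrightarrow> normalised \<alpha> \<phi> u \<Longrightarrow>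
      viscosity_subsolution (Mplus lam Lam \<alpha> \<phi>) (\<lambda>x. - u x) g (ball 0 1 \<inter> \<Omega>) \<Longrightarrow> (\<And>x. - \<delta>2 \<le> g x) \<Longrightarrow>
      \<forall>x\<in>cball x0 \<rho>. c \<le> u x"
    using local_lower_bound[OF \<open>0 < \<rho>\<close>, where 'a='a] by blast
  obtain \<delta>3 C where \<delta>3: "0 < \<delta>3" and C: "0 < C" and compare:
    "\<And>\<Omega> x0 (u1 :: 'a \<Rightarrow> real) u2 g. open \<Omega> \<Longrightarrow> ball x0 (2 * \<rho>) \<subseteq> \<Omega> \<inter> ball 0 (1/2) \<Longrightarrow>
      continuous_on (ball 0 1) u1 \<Longrightarrow> continuous_on (ball 0 1) u2 \<Longrightarrow>
      (\<And>x. 0 \<le> u1 x) \<Longrightarrow> (\<And>x. 0 \<le> u2 x) \<Longrightarrow> (\<And>x. x \<in> ball 0 1 - \<Omega> \<Longrightarrow> u1 x = 0) \<Longrightarrow>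
      normalised \<alpha> \<phi> u1 \<Longrightarrow> \<forall>x\<in>cball 0 (7/8). u1 x \<le> M \<Longrightarrow> \<forall>x\<in>cball x0 \<rho>. c \<le> u2 x \<Longrightarrow>
      viscosity_subsolution (Mplus lam Lam \<alpha> \<phi>) (\<lambda>x. u1 x - C * u2 x) g (ball 0 1 \<inter> \<Omega>) \<Longrightarrow>
      (\<And>x. - \<delta>3 \<le> g x) \<Longrightarrow> \<forall>x\<in>ball 0 (1/2). u1 x \<le> C * u2 x"
    using quotient_upper_bound[OF \<open>0 < \<rho>\<close> M c, where 'a='a] by blast
  \<comment> \<open>The last entry absorbs the coefficient sum \<open>1 + C\<close> of
    \<open>u1 - C * u2\<close>; \<open>C\<close> does not depend on \<open>\<delta>\<close>, so
    there is no circularity.\<close>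
  define \<delta> where "\<delta> = min (min \<delta>1 \<delta>2) (\<delta>3 / (1 + C))"
  have \<delta>: "0 < \<delta>" "\<delta> \<le> \<delta>1" "\<delta> \<le> \<delta>2" "\<delta> * (1 + C) \<le> \<delta>3"
  proof -
    show "0 < \<delta>" "\<delta> \<le> \<delta>1" "\<delta> \<le> \<delta>2" using \<delta>1 \<delta>2 \<delta>3 C by (auto simp: \<delta>_def)
    have "\<delta> \<le> \<delta>3 / (1 + C)" by (simp add: \<delta>_def)
    then show "\<delta> * (1 + C) \<le> \<delta>3" using C by (simp add: pos_le_divide_eq)
  qed
  show ?thesis
  proof (rule exI[of _ \<delta>], intro conjI exI[of _ C] allI impI)
    fix \<Omega> and x0 :: 'a and u1 u2 :: "'a \<Rightarrow> real"
    assume "open \<Omega> \<and>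
      x0 \<in> ball 0 (1/2) \<and> ball x0 (2 * \<rho>) \<subseteq> \<Omega> \<inter> ball 0 (1/2) \<and>
      continuous_on (ball 0 1) u1 \<and> continuous_on (ball 0 1) u2 \<and>
      (\<forall>a b :: real. viscosity_subsolution (Mplus lam Lam \<alpha> \<phi>) (\<lambda>x. a * u1 x + b * u2 x)
          (\<lambda>x. - \<delta> * (\<bar>a\<bar> + \<bar>b\<bar>)) (ball 0 1 \<inter> \<Omega>)) \<and>
      (\<forall>x\<in>ball 0 1 - \<Omega>. u1 x = 0 \<and> u2 x = 0) \<and>
      (\<forall>x. 0 \<le> u1 x) \<and> (\<forall>x. 0 \<le> u2 x) \<and>
      normalised \<alpha> \<phi> u1 \<and> normalised \<alpha> \<phi> u2"
    then have \<Omega>: "open \<Omega>" and sub: "ball x0 (2 * \<rho>) \<subseteq> \<Omega> \<inter> ball 0 (1/2)"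
      and cont: "continuous_on (ball 0 1) u1" "continuous_on (ball 0 1) u2"
      and visc: "\<And>a b. viscosity_subsolution (Mplus lam Lam \<alpha> \<phi>) (\<lambda>x. a * u1 x + b * u2 x)
          (\<lambda>x. - \<delta> * (\<bar>a\<bar> + \<bar>b\<bar>)) (ball 0 1 \<inter> \<Omega>)"
      and vanish: "\<And>x. x \<in> ball 0 1 - \<Omega> \<Longrightarrow> u1 x = 0" "\<And>x. x \<in> ball 0 1 - \<Omega> \<Longrightarrow> u2 x = 0"
      and nonneg: "\<And>x. 0 \<le> u1 x" "\<And>x. 0 \<le> u2 x"
      and normed: "normalised \<alpha> \<phi> u1" "normalised \<alpha> \<phi> u2"
      by auto
    have u1_le: "\<forall>x\<in>cball 0 (7/8). u1 x \<le> M"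
      using upper[OF \<Omega> cont(1) nonneg(1) vanish(1) normed(1), of "\<lambda>_. - \<delta>"] visc[of 1 0] \<delta> by simp
    have u2_le: "\<forall>x\<in>cball 0 (7/8). u2 x \<le> M"
      using upper[OF \<Omega> cont(2) nonneg(2) vanish(2) normed(2), of "\<lambda>_. - \<delta>"] visc[of 0 1] \<delta> by simp
    \<comment> \<open>The coefficient \<open>-1\<close> is admissible because the hypothesis ranges
      over all real combinations; it supplies the supersolution property.\<close>
    have u1_ge: "\<forall>x\<in>cball x0 \<rho>. c \<le> u1 x"
      using lower[OF sub cont(1) nonneg(1) normed(1), of "\<lambda>_. - \<delta>"] visc[of "-1" 0] \<delta> by simp
    have u2_ge: "\<forall>x\<in>cball x0 \<rho>. c \<le> u2 x"
      using lower[OF sub cont(2) nonneg(2) normed(2), of "\<lambda>_. - \<delta>"] visc[of 0 "-1"] \<delta> by simp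
    have "\<forall>x\<in>ball 0 (1/2). u1 x \<le> C * u2 x"
      using compare[OF \<Omega> sub cont nonneg vanish(1) normed(1) u1_le u2_ge, of "\<lambda>_. - \<delta> * (1 + C)"]
        visc[of 1 "- C"] \<delta> C by simp
    moreover have "\<forall>x\<in>ball 0 (1/2). u2 x \<le> C * u1 x"
      using compare[OF \<Omega> sub cont(2,1) nonneg(2,1) vanish(2) normed(2) u2_le u1_ge, of "\<lambda>_. - \<delta> * (1 + C)"]
        visc[of "- C" 1] \<delta> C by (simp add: add.commute)
    ultimately show "\<forall>x\<in>ball 0 (1/2). inverse C * u2 x \<le> u1 x \<and> u1 x \<le> C * u2 x"
      using C by (simp add: field_simps)
  qed (use \<delta> C in auto)
qed

end
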